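(* For each $n$ let $n_1=n_1(n)$ and $n_2=n_2(n)$ with $n_1+n_2=n$, let $\Lambda_1,\Lambda_2$ be disjoint sets of nodes with $|\Lambda_1|=n_1$, $|\Lambda_2|=n_2$, and let $\mathcal{G}_{n_1,n_2}$ be the set of all bi-partite graphs with layers $\Lambda_1,\Lambda_2$. Let $\vec{k}_{1\to2}^*=(k_i^* )_{i\in\Lambda_1}$ and $\vec{k}_{2\to1}^*=(k'^*_j)_{j\in\Lambda_2}$ be degree sequences that are simultaneously realised by at least one graph in $\mathcal{G}_{n_1,n_2}$, and consider the microcanonical and canonical ensembles $P_{\mathrm{mic}},P_{\mathrm{can}}$ on $\mathcal{G}_{n_1,n_2}$ with constraint $\vec{C}^*=\{\vec{k}_{1\to2}^*,\vec{k}_{2\to1}^*\}$ on the degree sequences of both layers. Put $L^*=\sum_{i\in\Lambda_1}k_i^*=\sum_{j\in\Lambda_2}k'^*_j$, $m^*=\max_{i\in\Lambda_1}k_i^*$, $m'^*=\max_{j\in\Lambda_2}k'^*_j$, $f_{1\to2}^{(n_1)}=n_1^{-1}\sum_{i\in\Lambda_1}\delta_{k_i^*}$ and $f_{2\to1}^{(n_2)}=n_2^{-1}\sum_{j\in\Lambda_2}\delta_{k'^*_j}$. Suppose that the limits $$A_1=\lim_{n\to\infty}\frac{n_1}{n_1+n_2},\qquad A_2=\lim_{n\to\infty}\frac{n_2}{n_1+n_2}$$ exist, that $$m^*m'^*=o\big({L^*}^{2/3}\big),\qquad n\to\infty,$$ and that there exist probability distributions $f_{1\to2},f_{2\to1}$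 on $\mathbb{N}_0$ such that $$\lim_{n\to\infty}\|f_{1\to2}^{(n_1)}-f_{1\to2}\|_{\ell^1(g)}=0,\qquad \lim_{n\to\infty}\|f_{2\to1}^{(n_2)}-f_{2\to1}\|_{\ell^1(g)}=0.$$ Then $$s_\infty=\lim_{n\to\infty}\frac{S_{n_1+n_2}(P_{\mathrm{mic}}\mid P_{\mathrm{can}})}{n_1+n_2}=A_1\,\|f_{1\to2}\|_{\ell^1(g)}+A_2\,\|f_{2\to1}\|_{\ell^1(g)}.$$
   Context: $\mathbb{N}_0=\{0,1,2,\ldots\}$; $\delta_k$ is the point measure at $k$. Graphs are simple and undirected, with adjacency entries $g_{i,j}(\mathbf{G})\in\{0,1\}$. A graph is bi-partite with layers $\Lambda_1,\Lambda_2$ if its node set is $\Lambda_1\cup\Lambda_2$ and $g_{i,j}(\mathbf{G})=0$ whenever $i,j\in\Lambda_1$ or $i,j\in\Lambda_2$. The degree sequence of layer $1$ is $\vec k_{1\to2}(\mathbf{G})=(\sum_{j\in\Lambda_2}g_{i,j}(\mathbf{G}))_{i\in\Lambda_1}$ and that of layer $2$ is $\vec k_{2\to1}(\mathbf{G})=(\sum_{i\in\Lambda_1}g_{i,j}(\mathbf{G}))_{j\in\Lambda_2}$. Ensembles: given a finite set $\mathcal{G}$ of graphs, a vector-valued function $\vec C$ on $\mathcal{G}$ and a value $\vec C^*$ attained by $\vec C$ for at least one graph in $\mathcal{G}$, the microcanonical distribution is $P_{\mathrm{mic}}(\mathbf{G})=1/\Omega_{\vec C^*}$ if $\vec C(\mathbf{G})=\vec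 C^*$ and $0$ otherwise, where $\Omega_{\vec C^*}=|\{\mathbf{G}\in\mathcal{G}\colon\vec C(\mathbf{G})=\vec C^*\}|$. The canonical distribution $P_{\mathrm{can}}$ is the probability distribution on $\mathcal{G}$ that maximises the entropy $-\sum_{\mathbf{G}\in\mathcal{G}}P(\mathbf{G})\ln P(\mathbf{G})$ subject to $\sum_{\mathbf{G}\in\mathcal{G}}P(\mathbf{G})\,\vec C(\mathbf{G})=\vec C^*$; it has the form $P_{\mathrm{can}}(\mathbf{G})=e^{-\vec\theta^*\cdot\vec C(\mathbf{G})}/Z(\vec\theta^* )$ with $Z(\vec\theta)=\sum_{\mathbf{G}\in\mathcal{G}}e^{-\vec\theta\cdot\vec C(\mathbf{G})}$ and $\vec\theta^*$ chosen such that the average of $\vec C$ equals $\vec C^*$. The relative entropy, with $n=n_1+n_2$ the number of nodes, is $S_n(P_{\mathrm{mic}}\mid P_{\mathrm{can}})=\sum_{\mathbf{G}\in\mathcal{G}}P_{\mathrm{mic}}(\mathbf{G})\ln\frac{P_{\mathrm{mic}}(\mathbf{G})}{P_{\mathrm{can}}(\mathbf{G})}$. The function $g\colon\mathbb{N}_0\to[0,\infty)$ is $g(k)=\log\left(\frac{k!}{k^ke^{-k}}\right)$ (so $g(0)=0$), and $\|h\|_{\ell^1(g)}=\sum_{k\in\mathbb{N}_0}|h(k)|\,g(k)$. *)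

theory Defs
  imports "HOL-Probability.Probability" "HOL-Library.Landau_Symbols"
begin

section \<open>Bipartite graphs\<close>

text \<open>A simple graph on the node set \<open>V\<close> is represented by its set of edges, each edge being a
  two-element set of nodes.\<close>

definition simple_graph :: "'v set \<Rightarrow> 'v set set \<Rightarrow> bool" where
  "simple_graph V E \<longleftrightarrow> (\<forall>e\<in>E. \<exists>u\<in>V. \<exists>v\<in>V. u \<noteq> v \<and> e = {u, v})"

definition adj :: "'v set set \<Rightarrow> 'v \<Rightarrow> 'v \<Rightarrow> nat" where
  "adj E i j = (if {i, j} \<in> E then 1 else 0)"

definition bipartite_graphs :: "'v set \<Rightarrow> 'v set \<Rightarrow> 'v set set set" where
  "bipartite_graphs V W = {E. simple_graph (V \<union> W) E \<and>
     (\<forall>i j. i \<in> V \<and> j \<in> V \<or> i \<in> W \<and> j \<in> W \<longrightarrow> adj E i j = 0)}"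

definition layer1_degree :: "'v set \<Rightarrow> 'v set set \<Rightarrow> 'v \<Rightarrow> nat" where
  "layer1_degree W E i = (\<Sum>j\<in>W. adj E i j)"

definition layer2_degree :: "'v set \<Rightarrow> 'v set set \<Rightarrow> 'v \<Rightarrow> nat" where
  "layer2_degree V E j = (\<Sum>i\<in>V. adj E i j)"

section \<open>Ensembles\<close>

text \<open>Throughout this section \<open>\<G>\<close> is a finite set of configurations, \<open>C G\<close> is a vector with
  components \<open>C G i\<close> for \<open>i \<in> I\<close>, and \<open>c\<close> is the prescribed value of this vector. Components
  outside the finite index set \<open>I\<close> are ignored.\<close>

definition satisfying :: "'g set \<Rightarrow> 'i set \<Rightarrow> ('g \<Rightarrow> 'i \<Rightarrow> real) \<Rightarrow> ('i \<Rightarrow> real) \<Rightarrow> 'g set" where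
  "satisfying \<G> I C c = {G\<in>\<G>. \<forall>i\<in>I. C G i = c i}"

definition microcanonical ::
    "'g set \<Rightarrow> 'i set \<Rightarrow> ('g \<Rightarrow> 'i \<Rightarrow> real) \<Rightarrow> ('i \<Rightarrow> real) \<Rightarrow> 'g \<Rightarrow> real" where
  "microcanonical \<G> I C c G =
     (if G \<in> satisfying \<G> I C c then 1 / real (card (satisfying \<G> I C c)) else 0)"

definition prob_dist_on :: "'g set \<Rightarrow> ('g \<Rightarrow> real) \<Rightarrow> bool" where
  "prob_dist_on \<G> P \<longleftrightarrow> (\<forall>G\<in>\<G>. 0 \<le> P G) \<and> (\<Sum>G\<in>\<G>. P G) = 1"

definition gibbs_entropy :: "'g set \<Rightarrow> ('g \<Rightarrow> real) \<Rightarrow> real" where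
  "gibbs_entropy \<G> P = - (\<Sum>G\<in>\<G>. P G * ln (P G))"

definition mean_constraint ::
    "'g set \<Rightarrow> 'i set \<Rightarrow> ('g \<Rightarrow> 'i \<Rightarrow> real) \<Rightarrow> ('i \<Rightarrow> real) \<Rightarrow> ('g \<Rightarrow> real) \<Rightarrow> bool" where
  "mean_constraint \<G> I C c P \<longleftrightarrow> (\<forall>i\<in>I. (\<Sum>G\<in>\<G>. P G * C G i) = c i)"

text \<open>The canonical distribution is characterised by the maximum entropy principle, not by the
  formula \<open>exp (- (\<theta> \<bullet> C G)) / Z \<theta>\<close>: the maximiser always exists and is unique on \<open>\<G>\<close> when \<open>c\<close>
  is attained, whereas a finite \<open>\<theta>\<close> does not exist when \<open>c\<close> lies on the boundary of the convex hull
  of the attained values, for instance when some prescribed degree is \<open>0\<close>.\<close>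

definition is_canonical ::
    "'g set \<Rightarrow> 'i set \<Rightarrow> ('g \<Rightarrow> 'i \<Rightarrow> real) \<Rightarrow> ('i \<Rightarrow> real) \<Rightarrow> ('g \<Rightarrow> real) \<Rightarrow> bool" where
  "is_canonical \<G> I C c P \<longleftrightarrow>
     prob_dist_on \<G> P \<and> mean_constraint \<G> I C c P \<and>
     (\<forall>Q. prob_dist_on \<G> Q \<and> mean_constraint \<G> I C c Q \<longrightarrow>
        gibbs_entropy \<G> Q \<le> gibbs_entropy \<G> P)"

text \<open>Summands with \<open>P G = 0\<close> vanish, as in the usual convention \<open>0 ln 0 = 0\<close>. The case
  \<open>Q G = 0 < P G\<close>, in which the relative entropy should be infinite, does not occur for \<open>P\<close>
  microcanonical and \<open>Q\<close> canonical: an entropy maximiser is positive on every \<open>G \<in> \<G>\<close> that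
  satisfies the constraint.\<close>

definition relative_entropy :: "'g set \<Rightarrow> ('g \<Rightarrow> real) \<Rightarrow> ('g \<Rightarrow> real) \<Rightarrow> real" where
  "relative_entropy \<G> P Q = (\<Sum>G\<in>\<G>. P G * ln (P G / Q G))"

section \<open>The constraint on the degrees of both layers\<close>

text \<open>The two degree sequences are joined into one vector indexed by the disjoint sum
  \<open>V <+> W\<close> of the layers.\<close>

definition both_degrees :: "'v set \<Rightarrow> 'v set \<Rightarrow> 'v set set \<Rightarrow> 'v + 'v \<Rightarrow> real" where
  "both_degrees V W E s = real (case_sum (layer1_degree W E) (layer2_degree V E) s)"

definition both_targets :: "('v \<Rightarrow> nat) \<Rightarrow> ('v \<Rightarrow> nat) \<Rightarrow> 'v + 'v \<Rightarrow> real" where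
  "both_targets k k' s = real (case_sum k k' s)"

definition degree_microcanonical ::
    "'v set \<Rightarrow> 'v set \<Rightarrow> ('v \<Rightarrow> nat) \<Rightarrow> ('v \<Rightarrow> nat) \<Rightarrow> 'v set set \<Rightarrow> real" where
  "degree_microcanonical V W k k' =
     microcanonical (bipartite_graphs V W) (V <+> W) (both_degrees V W) (both_targets k k')"

definition is_degree_canonical ::
    "'v set \<Rightarrow> 'v set \<Rightarrow> ('v \<Rightarrow> nat) \<Rightarrow> ('v \<Rightarrow> nat) \<Rightarrow> ('v set set \<Rightarrow> real) \<Rightarrow> bool" where
  "is_degree_canonical V W k k' P \<longleftrightarrow>
     is_canonical (bipartite_graphs V W) (V <+> W) (both_degrees V W) (both_targets k k') P"

section \<open>Empirical degree distributions and the weighted norm\<close>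

definition empirical :: "'v set \<Rightarrow> ('v \<Rightarrow> nat) \<Rightarrow> nat \<Rightarrow> real" where
  "empirical V k q = (\<Sum>i\<in>V. indicator {k i} q) / real (card V)"

definition stirling_g :: "nat \<Rightarrow> real" where
  "stirling_g k = ln (fact k / (real k ^ k * exp (- real k)))"

text \<open>The norm takes values in the extended reals because the series may diverge.\<close>

definition l1g_norm :: "(nat \<Rightarrow> real) \<Rightarrow> ereal" where
  "l1g_norm h = (\<Sum>k. ereal (\<bar>h k\<bar> * stirling_g k))"

end

theory Submission
  imports Defs
begin

text \<open>
  Perturbing the entropy maximiser towards the microcanonical distribution shows that the relative
  entropy equals \<open>H(P\<^sub>c\<^sub>a\<^sub>n) - ln \<Omega>\<close>, with \<open>\<Omega>\<close> the number of graphs that satisfy the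
  constraint. Write \<open>p\<^sub>i\<^sub>j = k\<^sub>i k'\<^sub>j / L\<close>. Gibbs' inequality against the weight \<open>\<Prod> p\<^sub>i\<^sub>j\<close> over the
  edges bounds \<open>H(P\<^sub>c\<^sub>a\<^sub>n)\<close> from above by
  \<open>L ln L + L - \<Sum> k\<^sub>i ln k\<^sub>i - \<Sum> k'\<^sub>j ln k'\<^sub>j\<close>, and independent edges with probabilities
  \<open>p\<^sub>i\<^sub>j\<close> satisfy the constraint on average and attain this value up to \<open>\<Sum> p\<^sub>i\<^sub>j\<^sup>2 \<le> m m'\<close>.

  For \<open>\<Omega>\<close>, list the edges: \<open>\<Omega> L!\<close> is the number of pairs of rearrangements of the two multisets of
  half-edges without a repeated pair, so \<open>\<Omega> \<le> L! / (\<Prod> k\<^sub>i! \<Prod> k'\<^sub>j!)\<close>. Conversely, by the lopsided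
  local lemma a random matching of the half-edges has no repeated pair with probability at least
  \<open>exp (- 8 m m')\<close> once \<open>64 m m' \<le> L\<close>. The difference of the two main terms is
  \<open>\<Sum> g(k\<^sub>i) + \<Sum> g(k'\<^sub>j) - g(L)\<close>, and \<open>L\<^sup>2 \<le> n\<^sup>2 m m'\<close> turns \<open>m m' = o(L\<^bsup>2/3\<^esup>)\<close> into
  \<open>m m' = o(n)\<close> and \<open>g(L) = O(ln n)\<close>.
\<close>

section \<open>A local lemma for permutations\<close>

text \<open>A quadruple \<open>((a, a'), (b, b'))\<close> stands for the event that a permutation
  sends \<open>a\<close> to \<open>b\<close> and \<open>a'\<close> to \<open>b'\<close>;
  \<open>S\<close> collects the bad events.\<close>

definition avoiding :: "'a set \<Rightarrow> (('a \<times> 'a) \<times> ('a \<times> 'a)) set \<Rightarrow> ('a \<Rightarrow> 'a) set" where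
  "avoiding A S = {\<sigma>. \<sigma> permutes A \<and> (\<forall>((a, a'), (b, b')) \<in> S. \<not> (\<sigma> a = b \<and> \<sigma> a' = b'))}"

definition hitting :: "('a \<times> 'a) \<times> ('a \<times> 'a) \<Rightarrow> ('a \<Rightarrow> 'a) set" where
  "hitting t = {\<sigma>. \<sigma> (fst (fst t)) = fst (snd t) \<and> \<sigma> (snd (fst t)) = snd (snd t)}"

text \<open>The dependency relation of the local lemma: sharing a source or a target. It is
  reflexive on events, so an event counts among its own conflicts.\<close>

definition conflict :: "('a \<times> 'a) \<times> ('a \<times> 'a) \<Rightarrow> ('a \<times> 'a) \<times> ('a \<times> 'a) \<Rightarrow> bool" where
  "conflict s t \<longleftrightarrow>
     {fst (fst s), snd (fst s)} \<inter> {fst (fst t), snd (fst t)} \<noteq> {} \<or>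
     {fst (snd s), snd (snd s)} \<inter> {fst (snd t), snd (snd t)} \<noteq> {}"

lemma avoiding_alt: "avoiding A S = {\<sigma>. \<sigma> permutes A} - (\<Union>t\<in>S. hitting t)"
  by (auto simp: avoiding_def hitting_def)

lemma finite_avoiding: "finite A \<Longrightarrow> finite (avoiding A S)"
  by (rule finite_subset[OF _ finite_permutations]) (auto simp: avoiding_def)

lemma card_distinct_pairs:
  assumes "finite A"
  shows "card {(c, c'). c \<in> A \<and> c' \<in> A \<and> c \<noteq> c'} = card A * (card A - 1)"
proof -
  have "{(c, c'). c \<in> A \<and> c' \<in> A \<and> c \<noteq> c'} = (SIGMA c:A. A - {c})" by auto
  also have "card \<dots> = (\<Sum>c\<in>A. card A - 1)"
    by (subst card_SigmaI) (use assms in \<open>auto intro!: sum.cong\<close>)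
  finally show ?thesis by simp
qed

text \<open>Redirecting the images of \<open>a\<close> and \<open>a'\<close> to an arbitrary pair creates no event that is
  not in conflict with \<open>((a, a'), (b, b'))\<close>: the only other values that appear are \<open>b\<close> and \<open>b'\<close>.\<close>

lemma card_hitting_avoiding_le:
  assumes A: "finite A" and t: "t = ((a, a'), (b, b'))"
    and ab: "a \<in> A" "a' \<in> A" "a \<noteq> a'" "b \<in> A" "b' \<in> A" "b \<noteq> b'"
    and nc: "\<And>s. s \<in> S \<Longrightarrow> \<not> conflict t s"
  shows "card (hitting t \<inter> avoiding A S) * (card A * (card A - 1)) \<le> card (avoiding A S)"
proof -
  define D where "D = {(c, c'). c \<in> A \<and> c' \<in> A \<and> c \<noteq> c'}"
  \<comment> \<open>First \<open>b\<close> goes to \<open>c\<close>; the second transposition then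
    sends the current image of \<open>b'\<close> to \<open>c'\<close> and leaves \<open>c\<close>
    alone when \<open>c \<noteq> c'\<close>.\<close>
  define \<tau> where "\<tau> = (\<lambda>c c'. Transposition.transpose (Transposition.transpose b c b') c' \<circ> Transposition.transpose b c)"
  have \<tau>1: "\<tau> c c' b = c" "\<tau> c c' b' = c'" if "c \<noteq> c'" for c c'
    using that ab by (auto simp: \<tau>_def Transposition.transpose_def)
  have \<tau>2: "\<tau> c c' x = x" if "x \<notin> {b, b', c, c'}" for c c' x
    using that by (auto simp: \<tau>_def Transposition.transpose_def)
  have \<tau>3: "\<tau> c c' permutes A" if "c \<in> A" "c' \<in> A" for c c'
    unfolding \<tau>_def
    by (intro permutes_compose permutes_swap_id) (use that ab in \<open>auto simp: Transposition.transpose_def\<close>)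
  have inj\<tau>: "inj (\<tau> c c')" for c c'
    unfolding \<tau>_def by (intro inj_compose inj_transpose)
  \<comment> \<open>Each permutation in the event yields one avoiding permutation for every ordered
    pair of distinct points. The pair is read off from the images of \<open>a\<close> and
    \<open>a'\<close>, so the map is injective.\<close>
  have "card ((hitting t \<inter> avoiding A S) \<times> D) \<le> card (avoiding A S)"
  proof (rule card_inj_on_le[where f = "\<lambda>(\<sigma>, (c, c')). \<tau> c c' \<circ> \<sigma>"])
    show "inj_on (\<lambda>(\<sigma>, (c, c')). \<tau> c c' \<circ> \<sigma>) ((hitting t \<inter> avoiding A S) \<times> D)"
    proof (rule inj_onI, clarsimp)
      fix \<sigma> c c' \<rho> d d'
      assume h: "\<sigma> \<in> hitting t" "\<rho> \<in> hitting t" "(c, c') \<in> D" "(d, d') \<in> D"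
        and eq: "\<tau> c c' \<circ> \<sigma> = \<tau> d d' \<circ> \<rho>"
      from fun_cong[OF eq, of a] fun_cong[OF eq, of a'] h have "c = d" "c' = d'"
        by (auto simp: hitting_def t D_def \<tau>1)
      with eq inj\<tau>[of d d'] show "\<sigma> = \<rho> \<and> c = d \<and> c' = d'"
        by (auto simp: fun_eq_iff inj_def)
    qed
    show "(\<lambda>(\<sigma>, (c, c')). \<tau> c c' \<circ> \<sigma>) ` ((hitting t \<inter> avoiding A S) \<times> D) \<subseteq> avoiding A S"
    proof clarsimp
      fix \<sigma> c c' assume h: "\<sigma> \<in> hitting t" "\<sigma> \<in> avoiding A S" "(c, c') \<in> D"
      have perm: "\<sigma> permutes A" using h by (auto simp: avoiding_def)
      have \<sigma>ab: "\<sigma> a = b" "\<sigma> a' = b'" using h by (auto simp: hitting_def t)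
      have cc: "c \<noteq> c'" "c \<in> A" "c' \<in> A" using h by (auto simp: D_def)
      have inj: "inj (\<tau> c c' \<circ> \<sigma>)"
        using permutes_inj[OF perm] inj\<tau> by (rule inj_compose[rotated])
      \<comment> \<open>\<open>c\<close> and \<open>c'\<close> are already the images of
        \<open>a\<close> and \<open>a'\<close>, so no other point takes them, and
        \<open>\<tau> c c'\<close> fixes every remaining value outside
        \<open>{b, b'}\<close>.\<close>
      have *: "\<sigma> x = u" if "(\<tau> c c' \<circ> \<sigma>) x = u" "u \<notin> {b, b'}" "x \<notin> {a, a'}" for x u
      proof -
        have "u \<noteq> c"
          using that injD[OF inj, of x a] \<tau>1[of c c'] cc \<sigma>ab by auto
        moreover have "u \<noteq> c'"
          using that injD[OF inj, of x a'] \<tau>1[of c c'] cc \<sigma>ab by auto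
        ultimately have "\<tau> c c' u = u" using that by (intro \<tau>2) auto
        with that(1) injD[OF inj\<tau>[of c c'], of "\<sigma> x" u] show ?thesis by simp
      qed
      show "\<tau> c c' \<circ> \<sigma> \<in> avoiding A S"
        unfolding avoiding_def
      proof (clarsimp simp del: o_apply, intro conjI)
        show "\<tau> c c' \<circ> \<sigma> permutes A" by (rule permutes_compose[OF perm \<tau>3]) (use cc in auto)
        show "\<forall>x\<in>S. case x of (x, xa) \<Rightarrow> (case x of (a, a') \<Rightarrow> \<lambda>(b, b'). (\<tau> c c' \<circ> \<sigma>) a = b \<longrightarrow> (\<tau> c c' \<circ> \<sigma>) a' \<noteq> b') xa"
        proof (clarsimp simp del: o_apply)
          fix x x'
          assume s: "((x, x'), ((\<tau> c c' \<circ> \<sigma>) x, (\<tau> c c' \<circ> \<sigma>) x')) \<in> S"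
          have "x \<notin> {a, a'}" "x' \<notin> {a, a'}"
            "(\<tau> c c' \<circ> \<sigma>) x \<notin> {b, b'}" "(\<tau> c c' \<circ> \<sigma>) x' \<notin> {b, b'}"
            using nc[OF s] unfolding conflict_def t fst_conv snd_conv by blast+
          then have "\<sigma> x = (\<tau> c c' \<circ> \<sigma>) x" "\<sigma> x' = (\<tau> c c' \<circ> \<sigma>) x'"
            using * by blast+
          with s have "((x, x'), (\<sigma> x, \<sigma> x')) \<in> S" by metis
          with h(2) show False by (auto simp: avoiding_def)
        qed
      qed
    qed
  qed (rule finite_avoiding[OF A])
  then show ?thesis by (simp add: card_cartesian_product D_def card_distinct_pairs[OF A])
qed

section \<open>Lopsided local lemma for a uniformly random permutation\<close>

locale permutation_events =
  fixes A :: "'a set" and T :: "(('a \<times> 'a) \<times> ('a \<times> 'a)) set"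
  assumes finite_A: "finite A" and finite_T: "finite T" and card_A: "2 \<le> card A"
    and T: "\<And>a a' b b'. ((a, a'), (b, b')) \<in> T \<Longrightarrow>
       a \<in> A \<and> a' \<in> A \<and> a \<noteq> a' \<and> b \<in> A \<and> b' \<in> A \<and> b \<noteq> b'"
    and few_conflicts: "\<And>t. t \<in> T \<Longrightarrow> 4 * card {s \<in> T. conflict t s} \<le> card A * (card A - 1)"
begin

text \<open>Probability that a uniformly random permutation of \<open>A\<close> sends two given
  distinct points to two given distinct values. In these terms \<open>few_conflicts\<close> is the
  symmetric condition \<open>4 * p * d \<le> 1\<close>, with \<open>d\<close> the number of
  conflicts.\<close>

definition p :: real where "p = 1 / (real (card A) * real (card A - 1))"

lemma p_nonneg: "0 \<le> p" by (simp add: p_def)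

text \<open>Conditioning on the avoidance of events not in conflict with \<open>t\<close> does not
  lift the probability of \<open>t\<close> above \<open>p\<close>. This one-sided bound replaces
  independence, which fails for permutations.\<close>

lemma lopsided:
  assumes "t \<in> T" "\<And>s. s \<in> S \<Longrightarrow> \<not> conflict t s"
  shows "real (card (hitting t \<inter> avoiding A S)) \<le> p * real (card (avoiding A S))"
proof -
  obtain a a' b b' where t: "t = ((a, a'), (b, b'))" by (metis surj_pair)
  have "card (hitting t \<inter> avoiding A S) * (card A * (card A - 1)) \<le> card (avoiding A S)"
    using T[of a a' b b'] assms by (intro card_hitting_avoiding_le[OF finite_A t]) (auto simp: t)
  then have "real (card (hitting t \<inter> avoiding A S)) * (real (card A) * real (card A - 1))
      \<le> real (card (avoiding A S))"
    by (metis of_nat_mult of_nat_le_iff)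
  moreover have "0 < real (card A) * real (card A - 1)" using card_A by simp
  ultimately show ?thesis unfolding p_def
    by (subst times_divide_eq_left, subst pos_le_divide_eq) (simp_all add: mult_ac)
qed

text \<open>Strong induction on \<open>card S\<close>. The part \<open>S2\<close> without conflicts
  is harmless by \<open>lopsided\<close>; given that \<open>S2\<close> is avoided, the conflicting
  events \<open>S1\<close> have total probability at most 1/2, which accounts for the factor
  2.\<close>

lemma local_lemma:
  assumes "S \<subseteq> T" "t \<in> T" "t \<notin> S"
  shows "real (card (hitting t \<inter> avoiding A S)) \<le> 2 * p * real (card (avoiding A S))"
  using assms
proof (induction "card S" arbitrary: S t rule: less_induct)
  case less
  define S1 where "S1 = {s \<in> S. conflict t s}"
  define S2 where "S2 = S - S1"
  have fin: "finite S" using less.prems(1) finite_T finite_subset by blast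
  have 1: "real (card (hitting t \<inter> avoiding A S2)) \<le> p * real (card (avoiding A S2))"
    using less.prems by (intro lopsided) (auto simp: S1_def S2_def)
  \<comment> \<open>The induction hypothesis applies because an element of \<open>S1\<close> makes
    \<open>S2\<close> a proper subset of \<open>S\<close>.\<close>
  have 2: "real (card (hitting s \<inter> avoiding A S2)) \<le> 2 * p * real (card (avoiding A S2))" if "s \<in> S1" for s
  proof (rule less.hyps)
    have "S2 \<subset> S" using that by (auto simp: S1_def S2_def)
    then show "card S2 < card S" using fin psubset_card_mono by blast
  qed (use that less.prems in \<open>auto simp: S1_def S2_def\<close>)
  have sub: "avoiding A S2 \<subseteq> avoiding A S \<union> (\<Union>s\<in>S1. hitting s \<inter> avoiding A S2)"
    by (auto simp: avoiding_alt S2_def)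
  have fin1: "finite S1" using fin by (simp add: S1_def)
  have "card (avoiding A S2) \<le> card (avoiding A S \<union> (\<Union>s\<in>S1. hitting s \<inter> avoiding A S2))"
    by (intro card_mono sub) (auto intro!: finite_avoiding finite_A fin1)
  also have "\<dots> \<le> card (avoiding A S) + (\<Sum>s\<in>S1. card (hitting s \<inter> avoiding A S2))"
    by (rule order_trans[OF card_Un_le add_left_mono[OF card_UN_le[OF fin1]]])
  finally have "real (card (avoiding A S2)) \<le>
     real (card (avoiding A S)) + (\<Sum>s\<in>S1. real (card (hitting s \<inter> avoiding A S2)))"
    by (metis of_nat_add of_nat_le_iff of_nat_sum)
  also have "(\<Sum>s\<in>S1. real (card (hitting s \<inter> avoiding A S2)))
      \<le> (\<Sum>s\<in>S1. 2 * p * real (card (avoiding A S2)))"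
    by (rule sum_mono[OF 2])
  also have "\<dots> = (2 * p * real (card S1)) * real (card (avoiding A S2))" by simp
  also have "\<dots> \<le> 1 / 2 * real (card (avoiding A S2))"
  proof (rule mult_right_mono)
    have "card S1 \<le> card {s \<in> T. conflict t s}"
      using less.prems finite_T by (intro card_mono) (auto simp: S1_def)
    with few_conflicts[OF less.prems(2)] have "4 * card S1 \<le> card A * (card A - 1)" by linarith
    then have "4 * real (card S1) \<le> real (card A) * real (card A - 1)"
      by (metis of_nat_le_iff of_nat_mult of_nat_numeral)
    moreover have "0 < real (card A) * real (card A - 1)" using card_A by simp
    ultimately show "2 * p * real (card S1) \<le> 1 / 2"
      unfolding p_def by (auto simp del: of_nat_diff One_nat_def simp: divide_le_eq mult_ac)
  qed simp
  finally have 3: "real (card (avoiding A S2)) \<le> 2 * real (card (avoiding A S))" by simp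
  have "card (hitting t \<inter> avoiding A S) \<le> card (hitting t \<inter> avoiding A S2)"
    by (intro card_mono) (use finite_avoiding[OF finite_A] in \<open>auto simp: avoiding_alt S2_def\<close>)
  with 1 have "real (card (hitting t \<inter> avoiding A S)) \<le> p * real (card (avoiding A S2))" by linarith
  also have "\<dots> \<le> p * (2 * real (card (avoiding A S)))"
    by (intro mult_left_mono 3 p_nonneg)
  finally show ?case by simp
qed

text \<open>Chain rule: the events are excluded one after another, and each exclusion keeps at least
  a fraction \<open>1 - 2 * p\<close> of the permutations.\<close>

lemma card_avoiding_ge: "(1 - 2 * p) ^ card T * fact (card A) \<le> real (card (avoiding A T))"
proof -
  \<comment> \<open>Leads to \<open>2 * p \<le> 1\<close>, so that inequalities may be multiplied by
    \<open>1 - 2 * p\<close>.\<close>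
  have "2 * 1 \<le> card A * (card A - 1)" using card_A by (intro mult_mono) auto
  then have "2 \<le> real (card A) * real (card A - 1)" by (metis of_nat_le_iff of_nat_mult of_nat_numeral mult_1_right)
  then have p: "2 * p \<le> 1" unfolding p_def using divide_le_eq_1 by force
  have "(1 - 2 * p) ^ card S * fact (card A) \<le> real (card (avoiding A S))" if "S \<subseteq> T" for S
    using finite_subset[OF that finite_T] that
  proof (induction S rule: finite_induct)
    case empty
    then show ?case by (simp add: avoiding_def card_permutations finite_A)
  next
    case (insert t S)
    have "avoiding A (insert t S) = avoiding A S - (hitting t \<inter> avoiding A S)"
      by (auto simp: avoiding_alt)
    moreover have "card (hitting t \<inter> avoiding A S) \<le> card (avoiding A S)"
      by (intro card_mono finite_avoiding finite_A) auto
    ultimately have "real (card (avoiding A (insert t S))) =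
        real (card (avoiding A S)) - real (card (hitting t \<inter> avoiding A S))"
      by (simp add: card_Diff_subset finite_avoiding finite_A)
    moreover have "real (card (hitting t \<inter> avoiding A S)) \<le> 2 * p * real (card (avoiding A S))"
      using local_lemma[of S t] insert by simp
    moreover have "(1 - 2 * p) * ((1 - 2 * p) ^ card S * fact (card A)) \<le> (1 - 2 * p) * real (card (avoiding A S))"
      using insert p by (intro mult_left_mono) auto
    ultimately have "(1 - 2 * p) * ((1 - 2 * p) ^ card S * fact (card A)) \<le> real (card (avoiding A (insert t S)))"
      by (simp add: algebra_simps)
    then show ?case using insert by simp
  qed
  then show ?thesis by blast
qed

end

section \<open>Relations with prescribed marginals\<close>

text \<open>Positions are half-edges and entries are the nodes that carry them. Diagonal pairs and
  both orders are included, which is harmless for the upper bounds on its size.\<close>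

definition tied_pairs :: "'a list \<Rightarrow> (nat \<times> nat) set" where
  "tied_pairs xs = {(a, a'). a < length xs \<and> a' < length xs \<and> xs ! a = xs ! a'}"

lemma card_positions: "card {a. a < length xs \<and> xs ! a = x} = count (mset xs) x"
proof -
  have "count (mset xs) x = card {a. a < length xs \<and> x = xs ! a}"
    by (simp add: count_mset count_list_eq_length_filter length_filter_conv_card)
  also have "{a. a < length xs \<and> x = xs ! a} = {a. a < length xs \<and> xs ! a = x}" by blast
  finally show ?thesis by simp
qed

lemma finite_tied_pairs: "finite (tied_pairs xs)"
  by (rule finite_subset[of _ "{..<length xs} \<times> {..<length xs}"]) (auto simp: tied_pairs_def)

lemma card_tied_pairs_le:
  assumes "\<And>x. count (mset xs) x \<le> m"
  shows "card (tied_pairs xs) \<le> length xs * m"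
proof -
  have "tied_pairs xs = (SIGMA a:{..<length xs}. {a'. a' < length xs \<and> xs ! a' = xs ! a})"
    by (auto simp: tied_pairs_def)
  also have "card \<dots> = (\<Sum>a<length xs. count (mset xs) (xs ! a))"
    by (subst card_SigmaI) (auto simp: card_positions)
  also have "\<dots> \<le> (\<Sum>a<length xs. m)" by (intro sum_mono assms)
  finally show ?thesis by simp
qed

text \<open>Each of at most two positions has at most \<open>m\<close> partners and may be either
  coordinate of the pair, whence \<open>2 * 2 * m\<close>.\<close>

lemma card_tied_pairs_touching_le:
  assumes m: "\<And>x. count (mset xs) x \<le> m" and F: "finite F" "card F \<le> 2"
  shows "card {q \<in> tied_pairs xs. fst q \<in> F \<or> snd q \<in> F} \<le> 4 * m"
proof -
  define B where "B = (\<lambda>a. {a'. a' < length xs \<and> xs ! a' = xs ! a})"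
  have finB: "finite (B a)" for a by (simp add: B_def)
  have cB: "card (B a) \<le> m" for a using m by (simp add: B_def card_positions)
  have "(\<Sum>a\<in>F. card (B a)) \<le> card F * m" using sum_mono[OF cB] by simp
  also have "\<dots> \<le> 2 * m" using F by simp
  finally have *: "(\<Sum>a\<in>F. card (B a)) \<le> 2 * m" .
  have c1: "card (SIGMA a:F. B a) \<le> 2 * m"
    by (subst card_SigmaI) (use F finB * in auto)
  have "{q \<in> tied_pairs xs. fst q \<in> F \<or> snd q \<in> F} \<subseteq> (SIGMA a:F. B a) \<union> prod.swap ` (SIGMA a:F. B a)"
  proof
    fix q assume q: "q \<in> {q \<in> tied_pairs xs. fst q \<in> F \<or> snd q \<in> F}"
    obtain a a' where [simp]: "q = (a, a')" by force
    show "q \<in> (SIGMA a:F. B a) \<union> prod.swap ` (SIGMA a:F. B a)"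
      using q by (force simp: tied_pairs_def B_def image_iff)
  qed
  then have "card {q \<in> tied_pairs xs. fst q \<in> F \<or> snd q \<in> F}
      \<le> card ((SIGMA a:F. B a) \<union> prod.swap ` (SIGMA a:F. B a))"
    by (rule card_mono[rotated]) (use F finB in auto)
  also have "\<dots> \<le> card (SIGMA a:F. B a) + card (SIGMA a:F. B a)"
    by (rule order_trans[OF card_Un_le add_left_mono[OF card_image_le]])
       (use F finB in auto)
  finally show ?thesis using c1 by simp
qed

text \<open>Composition with one permutation carrying \<open>ys0\<close> to \<open>ys\<close> maps
  the stabiliser of \<open>ys0\<close> bijectively onto the fibre over \<open>ys\<close>.\<close>

lemma card_permute_list_fibre:
  assumes "mset ys = mset ys0"
  shows "card {\<sigma>. \<sigma> permutes {..<length ys0} \<and> permute_list \<sigma> ys0 = ys} =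
         card {\<sigma>. \<sigma> permutes {..<length ys0} \<and> permute_list \<sigma> ys0 = ys0}"
proof -
  define A where "A = {..<length ys0}"
  obtain p where p: "p permutes A" "permute_list p ys0 = ys"
    using mset_eq_permutation[OF assms] unfolding A_def by blast
  have len: "length ys = length ys0" using assms mset_eq_length by blast
  have "bij_betw (\<lambda>\<sigma>. \<sigma> \<circ> p) {\<sigma>. \<sigma> permutes A \<and> permute_list \<sigma> ys0 = ys0}
     {\<sigma>. \<sigma> permutes A \<and> permute_list \<sigma> ys0 = ys}"
  proof (rule bij_betw_byWitness[where f' = "\<lambda>\<sigma>. \<sigma> \<circ> inv p"])
    have "permute_list (inv p) ys = ys0"
    proof -
      have "permute_list (inv p) (permute_list p ys0) = permute_list (p \<circ> inv p) ys0"
        using permutes_inv[OF p(1)] by (subst permute_list_compose) (auto simp: A_def)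
      then show ?thesis using p by (simp add: permutes_inv_o)
    qed
    note * = this
    show "(\<lambda>\<sigma>. \<sigma> \<circ> p) ` {\<sigma>. \<sigma> permutes A \<and> permute_list \<sigma> ys0 = ys0}
      \<subseteq> {\<sigma>. \<sigma> permutes A \<and> permute_list \<sigma> ys0 = ys}"
      using p by (auto simp: permute_list_compose A_def intro: permutes_compose)
    show "(\<lambda>\<sigma>. \<sigma> \<circ> inv p) ` {\<sigma>. \<sigma> permutes A \<and> permute_list \<sigma> ys0 = ys}
      \<subseteq> {\<sigma>. \<sigma> permutes A \<and> permute_list \<sigma> ys0 = ys0}"
      using permutes_inv[OF p(1)] *
      by (auto simp: permute_list_compose A_def intro: permutes_compose)
  qed (use p in \<open>auto simp: o_assoc[symmetric] permutes_inv_o\<close>)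
  then show ?thesis by (simp add: bij_betw_same_card A_def)
qed

text \<open>A uniformly random permutation induces a uniformly random rearrangement of
  \<open>ys0\<close>, since all fibres have the size of the stabiliser.\<close>

lemma card_permute_list_vimage:
  assumes "Z \<subseteq> permutations_of_multiset (mset ys0)"
  shows "card {\<sigma>. \<sigma> permutes {..<length ys0} \<and> permute_list \<sigma> ys0 \<in> Z} =
     card Z * card {\<sigma>. \<sigma> permutes {..<length ys0} \<and> permute_list \<sigma> ys0 = ys0}"
proof -
  have fin: "finite Z" by (rule finite_subset[OF assms]) simp
  have "{\<sigma>. \<sigma> permutes {..<length ys0} \<and> permute_list \<sigma> ys0 \<in> Z} =
     (\<Union>ys\<in>Z. {\<sigma>. \<sigma> permutes {..<length ys0} \<and> permute_list \<sigma> ys0 = ys})" by auto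
  also have "card \<dots> = (\<Sum>ys\<in>Z. card {\<sigma>. \<sigma> permutes {..<length ys0} \<and> permute_list \<sigma> ys0 = ys})"
    by (rule card_UN_disjoint) (use fin in \<open>auto intro!: finite_subset[OF _ finite_permutations[of "{..<length ys0}"]]\<close>)
  also have "\<dots> = (\<Sum>ys\<in>Z. card {\<sigma>. \<sigma> permutes {..<length ys0} \<and> permute_list \<sigma> ys0 = ys0})"
    by (intro sum.cong refl card_permute_list_fibre) (use assms in \<open>auto simp: permutations_of_multiset_def\<close>)
  finally show ?thesis by simp
qed

section \<open>Random matchings of half-edges without repeated pairs\<close>

lemma one_minus_ge_exp: "exp (- (2 * x)) \<le> 1 - x" if "0 \<le> x" "x \<le> 1 / 2" for x :: real
proof -
  have "- x - 2 * x\<^sup>2 \<le> ln (1 - x)" using that by (intro ln_one_minus_pos_lower_bound)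
  moreover have "x * x \<le> (1 / 2) * x" using that by (intro mult_right_mono) auto
  then have "2 * x\<^sup>2 \<le> x" by (simp add: power2_eq_square)
  ultimately have "- (2 * x) \<le> ln (1 - x)" by simp
  then show ?thesis using that by (subst (asm) ln_ge_iff) auto
qed

text \<open>With \<open>xs\<close> fixed and \<open>ys0\<close> permuted uniformly, a repeated pair
  means that two positions tied in \<open>xs\<close> are sent to positions tied in
  \<open>ys0\<close>. There are at most \<open>(L * m) * (L * m')\<close> such events of probability
  about \<open>1 / L^2\<close>, so the local lemma leaves a fraction
  \<open>exp (- O(m * m'))\<close>.\<close>

lemma card_distinct_zip_ge:
  assumes m: "\<And>x. count (mset xs) x \<le> m" and m': "\<And>y. count (mset ys0) y \<le> m'"
    and len: "length xs = length ys0" and L: "64 * (m * m') \<le> length ys0" "0 < length ys0"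
  shows "exp (- (8 * (real m * real m'))) * real (card (permutations_of_multiset (mset ys0)))
    \<le> real (card {ys \<in> permutations_of_multiset (mset ys0). distinct (zip xs ys)})"
proof -
  define L where "L = length ys0"
  define A where "A = {..<L}"
  \<comment> \<open>One order of the two source positions suffices to detect a repetition, and
    \<open>b \<noteq> b'\<close> because a permutation never merges positions.\<close>
  define T where "T = {((a, a'), (b, b')). (a, a') \<in> tied_pairs xs \<and> (b, b') \<in> tied_pairs ys0 \<and> a < a' \<and> b \<noteq> b'}"
  define Z where "Z = {ys \<in> permutations_of_multiset (mset ys0). distinct (zip xs ys)}"
  define s where "s = card {\<sigma>. \<sigma> permutes A \<and> permute_list \<sigma> ys0 = ys0}"
  have "0 < count (mset xs) (xs ! 0)" "0 < count (mset ys0) (ys0 ! 0)"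
    using L(2) len by (simp_all only: count_greater_zero_iff set_mset_mset nth_mem)
  then have "1 \<le> m" "1 \<le> m'"
    using m[of "xs ! 0"] m'[of "ys0 ! 0"] by linarith+
  then have "1 * 1 \<le> m * m'" by (rule mult_le_mono)
  then have L64: "64 \<le> L" using L unfolding L_def by linarith
  have T_sub: "T \<subseteq> tied_pairs xs \<times> tied_pairs ys0" by (auto simp: T_def)
  have cardT: "card T \<le> (L * m) * (L * m')"
  proof -
    have "card T \<le> card (tied_pairs xs) * card (tied_pairs ys0)"
      using card_mono[OF _ T_sub] by (simp add: finite_tied_pairs card_cartesian_product)
    also have "\<dots> \<le> (L * m) * (L * m')"
      using card_tied_pairs_le[OF m] card_tied_pairs_le[OF m'] len
      by (intro mult_le_mono) (auto simp: L_def)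
    finally show ?thesis .
  qed
  interpret permutation_events A T
  proof
    show "finite A" "2 \<le> card A" using L64 by (auto simp: A_def)
    show "finite T" by (rule finite_subset[OF T_sub]) (simp add: finite_tied_pairs)
    show "a \<in> A \<and> a' \<in> A \<and> a \<noteq> a' \<and> b \<in> A \<and> b' \<in> A \<and> b \<noteq> b'" if "((a, a'), b, b') \<in> T" for a a' b b'
      using that len by (auto simp: T_def A_def L_def tied_pairs_def)
    fix t assume "t \<in> T"
    define F where "F = {fst (fst t), snd (fst t)}"
    define G where "G = {fst (snd t), snd (snd t)}"
    have FG: "finite F" "card F \<le> 2" "finite G" "card G \<le> 2"
      by (auto simp: F_def G_def card_insert_if)
    define U where "U = {q \<in> tied_pairs xs. fst q \<in> F \<or> snd q \<in> F}"
    define W where "W = {q \<in> tied_pairs ys0. fst q \<in> G \<or> snd q \<in> G}"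
    \<comment> \<open>A conflicting event meets \<open>t\<close> among the sources or among the
      targets and is unrestricted on the other side.\<close>
    have "{s \<in> T. conflict t s} \<subseteq> U \<times> tied_pairs ys0 \<union> tied_pairs xs \<times> W"
      by (auto simp: T_def conflict_def F_def G_def U_def W_def)
    then have "card {s \<in> T. conflict t s} \<le> card (U \<times> tied_pairs ys0 \<union> tied_pairs xs \<times> W)"
      by (rule card_mono[rotated]) (simp add: U_def W_def finite_tied_pairs)
    also have "\<dots> \<le> card U * card (tied_pairs ys0) + card (tied_pairs xs) * card W"
      by (rule order_trans[OF card_Un_le]) (simp add: card_cartesian_product)
    also have "\<dots> \<le> (4 * m) * (L * m') + (L * m) * (4 * m')"
      unfolding U_def W_def L_def using len
      by (intro add_mono mult_le_mono card_tied_pairs_touching_le card_tied_pairs_le m m' FG order_trans[OF card_tied_pairs_le[OF m]]) auto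
    \<comment> \<open>The constant is \<open>32 = 4 * (4 + 4)\<close>, and
      \<open>64 * (m * m') \<le> L\<close> gives
      \<open>32 * (m * m') \<le> L / 2 \<le> L - 1\<close>.\<close>
    finally have "4 * card {s \<in> T. conflict t s} \<le> L * (32 * (m * m'))" by (simp add: mult_ac)
    also have "\<dots> \<le> L * (L - 1)"
      using L L64 by (intro mult_le_mono) (auto simp: L_def)
    finally show "4 * card {s \<in> T. conflict t s} \<le> card A * (card A - 1)" by (simp add: A_def)
  qed
  have cA: "card A = L" by (simp add: A_def)
  have "avoiding A T \<subseteq> {\<sigma>. \<sigma> permutes A \<and> permute_list \<sigma> ys0 \<in> Z}"
  proof
    fix \<sigma> assume \<sigma>: "\<sigma> \<in> avoiding A T"
    have perm: "\<sigma> permutes {..<length ys0}" using \<sigma> by (auto simp: avoiding_def A_def L_def)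
    have "distinct (zip xs (permute_list \<sigma> ys0))"
    proof (rule ccontr)
      assume "\<not> ?thesis"
      then obtain a a' where a: "a < length ys0" "a' < length ys0" "a < a'"
        "zip xs (permute_list \<sigma> ys0) ! a = zip xs (permute_list \<sigma> ys0) ! a'"
        using len by (auto simp: distinct_conv_nth) (metis nat_neq_iff)
      then have "xs ! a = xs ! a'" "ys0 ! \<sigma> a = ys0 ! \<sigma> a'"
        using len perm by (auto simp: permute_list_nth)
      moreover have "\<sigma> a < length ys0" "\<sigma> a' < length ys0"
        using a permutes_in_image[OF perm] by auto
      moreover have "\<sigma> a \<noteq> \<sigma> a'" using a injD[OF permutes_inj[OF perm], of a a'] by auto
      ultimately have "((a, a'), (\<sigma> a, \<sigma> a')) \<in> T" using a len by (auto simp: T_def tied_pairs_def)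
      then show False using \<sigma> by (auto simp: avoiding_def)
    qed
    then show "\<sigma> \<in> {\<sigma>. \<sigma> permutes A \<and> permute_list \<sigma> ys0 \<in> Z}"
      using perm by (auto simp: Z_def A_def L_def permutations_of_multiset_def)
  qed
  then have "card (avoiding A T) \<le> card {\<sigma>. \<sigma> permutes A \<and> permute_list \<sigma> ys0 \<in> Z}"
    by (rule card_mono[rotated]) (auto intro!: finite_subset[OF _ finite_permutations[of A]] simp: A_def)
  also have "\<dots> = card Z * s"
    unfolding s_def A_def L_def by (rule card_permute_list_vimage) (auto simp: Z_def)
  finally have 1: "(1 - 2 * p) ^ card T * fact L \<le> real (card Z) * real s"
    using card_avoiding_ge by (simp add: cA flip: of_nat_mult)
  have "{\<sigma>. \<sigma> permutes {..<length ys0}} =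
      {\<sigma>. \<sigma> permutes {..<length ys0} \<and> permute_list \<sigma> ys0 \<in> permutations_of_multiset (mset ys0)}"
    by (auto simp: permutations_of_multiset_def)
  moreover have "card {\<sigma>. \<sigma> permutes {..<length ys0}} = fact L"
    by (rule card_permutations) (simp_all add: L_def)
  moreover have "card {\<sigma>. \<sigma> permutes {..<length ys0} \<and> permute_list \<sigma> ys0 \<in> permutations_of_multiset (mset ys0)}
      = card (permutations_of_multiset (mset ys0)) * s"
    unfolding s_def A_def L_def by (rule card_permute_list_vimage) simp
  \<comment> \<open>Orbit-stabiliser count for the permutations acting on
    \<open>ys0\<close>.\<close>
  ultimately have "fact L = card (permutations_of_multiset (mset ys0)) * s" by (simp only:)
  then have 2: "fact L = real (card (permutations_of_multiset (mset ys0))) * real s"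
    by (metis of_nat_fact of_nat_mult)
  have spos: "0 < real s"
    using 2 by (metis fact_gt_zero less_numeral_extra(3) mult_zero_right of_nat_0_le_iff order_le_less)
  have LL: "real L * real L \<le> 2 * (real L * real (L - 1))"
    using L64 by (simp add: of_nat_diff algebra_simps)
  have Lpos: "0 < real L * real (L - 1)" using L64 by simp
  have p_le: "p \<le> 2 / (real L * real L)"
    unfolding p_def cA using Lpos L64 LL by (simp add: divide_le_eq le_divide_eq mult_ac)
  have "2 / (real L * real L) \<le> 1 / 4"
  proof -
    have "real 64 * real 64 \<le> real L * real L" using L64 by (intro mult_mono) auto
    then show ?thesis using L64 by (simp add: divide_le_eq)
  qed
  with p_le have "2 * p \<le> 1 / 2" by simp
  then have "exp (- (2 * (2 * p))) ^ card T \<le> (1 - 2 * p) ^ card T"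
    using p_nonneg by (intro power_mono one_minus_ge_exp) auto
  \<comment> \<open>At most \<open>L^2 * m * m'\<close> factors, each at least
    \<open>exp (- 4 * p)\<close> with \<open>p \<le> 2 / L^2\<close>, give the constant
    \<open>8 = 4 * 2\<close>.\<close>
  moreover have "exp (- (8 * (real m * real m'))) \<le> exp (- (2 * (2 * p))) ^ card T"
  proof -
    have "real (card T) * (4 * p) \<le> (real L * real m * (real L * real m')) * (4 * (2 / (real L * real L)))"
      using cardT p_le p_nonneg by (intro mult_mono) (auto simp flip: of_nat_mult)
    also have "\<dots> = 8 * (real m * real m')" using L64 by simp
    finally show ?thesis by (simp flip: exp_of_nat_mult)
  qed
  ultimately have "exp (- (8 * (real m * real m'))) * fact L \<le> (1 - 2 * p) ^ card T * fact L"
    by (intro mult_right_mono) auto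
  with 1 have "exp (- (8 * (real m * real m'))) * fact L \<le> real (card Z) * real s" by linarith
  then show ?thesis unfolding 2 Z_def[symmetric] using spos by (simp add: mult.assoc[symmetric])
qed

text \<open>Simple bipartite graphs as relations: a set of pairs excludes repeated edges, while
  \<open>mset_set\<close> keeps the multiplicities of the projections, which are the
  degrees.\<close>

definition realisations :: "'a multiset \<Rightarrow> 'b multiset \<Rightarrow> ('a \<times> 'b) set set" where
  "realisations M N = {R. finite R \<and> image_mset fst (mset_set R) = M \<and> image_mset snd (mset_set R) = N}"

lemma card_realisation: "R \<in> realisations M N \<Longrightarrow> card R = size M"
  by (auto simp: realisations_def)

lemma realisations_subset_Pow: "realisations M N \<subseteq> Pow (set_mset M \<times> set_mset N)"
proof
  fix R assume R: "R \<in> realisations M N"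
  then have "set_mset M = fst ` R" "set_mset N = snd ` R"
    unfolding realisations_def by (metis (mono_tags, lifting) finite_set_mset_mset_set mem_Collect_eq set_image_mset)+
  then show "R \<in> Pow (set_mset M \<times> set_mset N)" by force
qed

lemma finite_realisations: "finite (realisations M N)"
  by (rule finite_subset[OF realisations_subset_Pow]) simp

text \<open>Listing the edges of a relation in one of their \<open>fact (size M)\<close> orders and
  separating the coordinates gives two rearrangements with distinct zip; zipping is the
  inverse.\<close>

lemma card_realisations_mult_fact:
  fixes M :: "'a multiset" and N :: "'b multiset"
  assumes "size M = size N"
  shows "card (realisations M N) * fact (size M) =
    card (SIGMA xs:permutations_of_multiset M. {ys \<in> permutations_of_multiset N. distinct (zip xs ys)})"
proof -
  define G where "G = (SIGMA xs:permutations_of_multiset M. {ys \<in> permutations_of_multiset N. distinct (zip xs ys)})"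
  define D where "D = (SIGMA R:realisations M N. permutations_of_set R)"
  define f :: "'a list \<times> 'b list \<Rightarrow> ('a \<times> 'b) set \<times> ('a \<times> 'b) list"
    where "f = (\<lambda>(xs, ys). (set (zip xs ys), zip xs ys))"
  define g :: "('a \<times> 'b) set \<times> ('a \<times> 'b) list \<Rightarrow> 'a list \<times> 'b list"
    where "g = (\<lambda>(R, zs). (map fst zs, map snd zs))"
  have len: "length xs = length ys" if "mset xs = M" "mset ys = N" for xs ys
    using that assms by (metis size_mset)
  have "bij_betw f G D"
  proof (rule bij_betwI[where g = g])
    show "g (f z) = z" if "z \<in> G" for z
      using that by (auto simp: permutations_of_multiset_def len f_def g_def G_def)
    show "f (g z) = z" if "z \<in> D" for z
      using that by (auto simp: permutations_of_set_def zip_map_fst_snd f_def g_def D_def)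
    show "f \<in> G \<rightarrow> D"
    proof (clarsimp simp: G_def)
      fix xs ys assume *: "xs \<in> permutations_of_multiset M" "ys \<in> permutations_of_multiset N" "distinct (zip xs ys)"
      have "mset_set (set (zip xs ys)) = mset (zip xs ys)" by (rule mset_set_set) fact
      moreover have "map fst (zip xs ys) = xs" "map snd (zip xs ys) = ys"
        using * len by (auto simp: permutations_of_multiset_def)
      ultimately show "f (xs, ys) \<in> D"
        using * by (auto simp: f_def D_def realisations_def permutations_of_set_def permutations_of_multiset_def simp flip: mset_map)
    qed
    show "g \<in> D \<rightarrow> G"
    proof (clarsimp simp: D_def)
      fix R zs assume *: "R \<in> realisations M N" "zs \<in> permutations_of_set R"
      then have "distinct zs" "set zs = R" by (auto simp: permutations_of_set_def)
      moreover from this have "mset_set R = mset zs" using mset_set_set by blast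
      ultimately show "g (R, zs) \<in> G"
        using * by (auto simp: g_def G_def realisations_def permutations_of_multiset_def zip_map_fst_snd)
    qed
  qed
  moreover have "card D = card (realisations M N) * fact (size M)"
  proof -
    have "card (SIGMA R:realisations M N. permutations_of_set R) = (\<Sum>R\<in>realisations M N. fact (card R))"
    proof (subst card_SigmaI)
      have "finite R" if "R \<in> realisations M N" for R using that by (simp add: realisations_def)
      then show "(\<Sum>R\<in>realisations M N. card (permutations_of_set R)) = (\<Sum>R\<in>realisations M N. fact (card R))"
        by simp
    qed (simp_all add: finite_realisations)
    then show ?thesis by (simp add: card_realisation D_def)
  qed
  ultimately show ?thesis using bij_betw_same_card unfolding G_def by force
qed

lemma card_realisations_le:
  assumes "size M = size N"
  shows "card (realisations M N) * fact (size M) \<le>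
    card (permutations_of_multiset M) * card (permutations_of_multiset N)"
proof -
  have "card (SIGMA xs:permutations_of_multiset M. {ys \<in> permutations_of_multiset N. distinct (zip xs ys)})
    \<le> card (permutations_of_multiset M \<times> permutations_of_multiset N)"
    by (intro card_mono) auto
  then show ?thesis by (simp add: card_realisations_mult_fact[OF assms] card_cartesian_product)
qed

text \<open>The bound of \<open>card_distinct_zip_ge\<close> is uniform in \<open>xs\<close>, so it
  can be summed over all rearrangements of \<open>M\<close>.\<close>

lemma card_realisations_ge:
  fixes M :: "'a multiset" and N :: "'b multiset"
  assumes sz: "size M = size N" and m: "\<And>x. count M x \<le> m" and m': "\<And>y. count N y \<le> m'"
    and L: "64 * (m * m') \<le> size N" "0 < size N"
  shows "exp (- (8 * (real m * real m'))) *
     (real (card (permutations_of_multiset M)) * real (card (permutations_of_multiset N)))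
     \<le> real (card (realisations M N)) * fact (size M)"
proof -
  define G where "G = (\<lambda>xs :: 'a list. {ys \<in> permutations_of_multiset N. distinct (zip xs ys)})"
  obtain ys0 where ys0: "mset ys0 = N" using ex_mset by blast
  have "exp (- (8 * (real m * real m'))) * real (card (permutations_of_multiset N)) \<le> real (card (G xs))"
    if "xs \<in> permutations_of_multiset M" for xs
    using that card_distinct_zip_ge[of xs m ys0 m'] m m' sz L ys0
    by (auto simp: permutations_of_multiset_def G_def)
  then have "(\<Sum>xs\<in>permutations_of_multiset M. exp (- (8 * (real m * real m'))) * real (card (permutations_of_multiset N)))
     \<le> (\<Sum>xs\<in>permutations_of_multiset M. real (card (G xs)))" by (rule sum_mono)
  also have "\<dots> = real (card (SIGMA xs:permutations_of_multiset M. G xs))"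
    by (subst card_SigmaI) (auto simp: G_def)
  also have "\<dots> = real (card (realisations M N)) * fact (size M)"
    unfolding G_def card_realisations_mult_fact[OF sz, symmetric] by simp
  finally show ?thesis by (simp add: mult_ac)
qed

section \<open>Entropy of the canonical distribution\<close>

lemma gibbs_entropy_le:
  assumes "finite \<G>" and P: "prob_dist_on \<G> P"
    and Q: "\<And>G. G \<in> \<G> \<Longrightarrow> 0 \<le> Q G" "(\<Sum>G\<in>\<G>. Q G) \<le> 1"
    and pos: "\<And>G. G \<in> \<G> \<Longrightarrow> 0 < P G \<Longrightarrow> 0 < Q G"
  shows "gibbs_entropy \<G> P \<le> - (\<Sum>G\<in>\<G>. P G * ln (Q G))"
proof -
  have "P G * ln (Q G) - P G * ln (P G) \<le> Q G - P G" if "G \<in> \<G>" for G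
  proof (cases "P G = 0")
    case False
    then have p: "0 < P G" "0 < Q G" using that P pos by (auto simp: prob_dist_on_def order.order_iff_strict)
    then have "P G * ln (Q G / P G) \<le> P G * (Q G / P G - 1)"
      by (intro mult_left_mono ln_le_minus_one) auto
    then show ?thesis using p by (simp add: ln_div right_diff_distrib)
  qed (use Q that in simp)
  then have "(\<Sum>G\<in>\<G>. P G * ln (Q G) - P G * ln (P G)) \<le> (\<Sum>G\<in>\<G>. Q G - P G)" by (rule sum_mono)
  then show ?thesis using P Q(2) by (simp add: sum_subtractf gibbs_entropy_def prob_dist_on_def)
qed

text \<open>Moving a small mass \<open>t\<close> to a configuration of weight 0 gains entropy
  \<open>- t * ln t\<close>, which beats the loss, linear in \<open>t\<close>, on the rest.\<close>

lemma canonical_positive: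
  assumes fin: "finite \<G>" and can: "is_canonical \<G> I C c P" and G0: "G0 \<in> satisfying \<G> I C c"
  shows "0 < P G0"
proof (rule ccontr)
  assume "\<not> 0 < P G0"
  have P: "prob_dist_on \<G> P" and mean: "mean_constraint \<G> I C c P"
    and max: "\<And>Q. prob_dist_on \<G> Q \<Longrightarrow> mean_constraint \<G> I C c Q \<Longrightarrow> gibbs_entropy \<G> Q \<le> gibbs_entropy \<G> P"
    using can by (auto simp: is_canonical_def)
  have G0\<G>: "G0 \<in> \<G>" "\<And>i. i \<in> I \<Longrightarrow> C G0 i = c i" using G0 by (auto simp: satisfying_def)
  have P0: "P G0 = 0" using \<open>\<not> 0 < P G0\<close> P G0\<G> unfolding prob_dist_on_def by fastforce
  \<comment> \<open>Chosen so that \<open>- ln t\<close> exceeds the entropy of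
    \<open>P\<close>.\<close>
  define t where "t = exp (- \<bar>gibbs_entropy \<G> P\<bar> - 1)"
  have t: "0 < t" "t < 1" by (auto simp: t_def)
  define Q where "Q = (\<lambda>G. (1 - t) * P G + t * of_bool (G = G0))"
  have sum_delta: "(\<Sum>G\<in>\<G>. of_bool (G = G0) * h G) = h G0" for h :: "_ \<Rightarrow> real"
    using fin G0\<G> by (subst sum.remove[of _ G0]) auto
  have "prob_dist_on \<G> Q"
    using P t sum_delta[of "\<lambda>_. 1"]
    by (auto simp: prob_dist_on_def Q_def sum.distrib simp flip: sum_distrib_left)
  moreover have "mean_constraint \<G> I C c Q"
    unfolding mean_constraint_def
  proof
    fix i assume i: "i \<in> I"
    have "(\<Sum>G\<in>\<G>. Q G * C G i) = (1 - t) * (\<Sum>G\<in>\<G>. P G * C G i) + t * (\<Sum>G\<in>\<G>. of_bool (G = G0) * C G i)"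
      unfolding Q_def by (simp add: algebra_simps sum.distrib sum_subtractf sum_distrib_left)
    then show "(\<Sum>G\<in>\<G>. Q G * C G i) = c i"
      using mean i G0\<G>(2)[OF i] sum_delta[of "\<lambda>G. C G i"]
      by (simp add: mean_constraint_def algebra_simps)
  qed
  ultimately have le: "gibbs_entropy \<G> Q \<le> gibbs_entropy \<G> P" by (rule max)
  \<comment> \<open>\<open>P\<close> and the point mass at \<open>G0\<close> have disjoint supports,
    so there are no cross terms.\<close>
  have QlnQ: "Q G * ln (Q G) = (1 - t) * (P G * ln (P G)) + (1 - t) * ln (1 - t) * P G + of_bool (G = G0) * (t * ln t)"
    if "G \<in> \<G>" for G
  proof (cases "P G = 0")
    case False
    then have "0 < P G" "G \<noteq> G0" using P that P0 by (auto simp: prob_dist_on_def order.order_iff_strict)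
    moreover from this have "ln ((1 - t) * P G) = ln (1 - t) + ln (P G)" using t by (intro ln_mult_pos) auto
    ultimately show ?thesis by (simp add: Q_def distrib_left)
  qed (auto simp: Q_def)
  have "(\<Sum>G\<in>\<G>. Q G * ln (Q G)) = (1 - t) * (\<Sum>G\<in>\<G>. P G * ln (P G)) + (1 - t) * ln (1 - t) * (\<Sum>G\<in>\<G>. P G) + t * ln t"
    using sum_delta[of "\<lambda>_. t * ln t"]
    by (simp add: QlnQ sum.distrib sum_distrib_left cong: sum.cong)
  then have "gibbs_entropy \<G> Q = (1 - t) * gibbs_entropy \<G> P - (1 - t) * ln (1 - t) - t * ln t"
    using P by (simp add: gibbs_entropy_def prob_dist_on_def algebra_simps)
  moreover have "(1 - t) * ln (1 - t) \<le> 0" using t by (intro mult_nonneg_nonpos) auto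
  moreover have "t * gibbs_entropy \<G> P < t * (- ln t)" using t by (intro mult_strict_left_mono) (auto simp: t_def)
  ultimately show False using le by (simp add: algebra_simps)
qed

text \<open>Since the maximiser is positive on the microcanonical support, it may be perturbed in both
  directions along \<open>P\<^sub>m\<^sub>i\<^sub>c - P\<^sub>c\<^sub>a\<^sub>n\<close>, so the derivative of the entropy in that direction
  vanishes. This replaces the explicit exponential form of the canonical distribution.\<close>

lemma relative_entropy_microcanonical:
  assumes fin: "finite \<G>" and can: "is_canonical \<G> I C c P" and ne: "satisfying \<G> I C c \<noteq> {}"
  shows "relative_entropy \<G> (microcanonical \<G> I C c) P
    = gibbs_entropy \<G> P - ln (real (card (satisfying \<G> I C c)))"
proof -
  define S where "S = satisfying \<G> I C c"
  define mic where "mic = microcanonical \<G> I C c"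
  define N where "N = real (card S)"
  have P: "prob_dist_on \<G> P" and mean: "mean_constraint \<G> I C c P"
    and max: "\<And>Q. prob_dist_on \<G> Q \<Longrightarrow> mean_constraint \<G> I C c Q \<Longrightarrow> gibbs_entropy \<G> Q \<le> gibbs_entropy \<G> P"
    using can by (auto simp: is_canonical_def)
  have S: "S \<subseteq> \<G>" "S \<noteq> {}" "finite S" using fin ne by (auto simp: S_def satisfying_def)
  have N: "1 \<le> N" using S by (simp add: N_def Suc_le_eq card_gt_0_iff)
  have mic: "mic G = (if G \<in> S then 1 / N else 0)" for G
    by (simp add: mic_def microcanonical_def S_def N_def)
  have sum_mic: "(\<Sum>G\<in>\<G>. mic G * h G) = (\<Sum>G\<in>S. h G) / N" for h
  proof -
    have "(\<Sum>G\<in>\<G>. mic G * h G) = (\<Sum>G\<in>S. mic G * h G)"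
      by (rule sum.mono_neutral_right) (use S fin in \<open>auto simp: mic\<close>)
    then show ?thesis by (simp add: mic sum_divide_distrib cong: sum.cong)
  qed
  have mic1: "(\<Sum>G\<in>\<G>. mic G) = 1"
    using sum_mic[of "\<lambda>_. 1"] N by (simp add: N_def)
  have mic01: "0 \<le> mic G" "mic G \<le> 1" for G using N by (auto simp: mic)
  have P01: "0 \<le> P G" "P G \<le> 1" if "G \<in> \<G>" for G
  proof -
    show "0 \<le> P G" using P that by (simp add: prob_dist_on_def)
    show "P G \<le> 1" using P that fin member_le_sum[of G \<G> P] by (auto simp: prob_dist_on_def)
  qed
  have Ppos: "0 < P G" if "G \<in> S" for G
    using canonical_positive[OF fin can] that by (simp add: S_def)
  define d where "d = (\<lambda>G. mic G - P G)"
  define \<phi> where "\<phi> = (\<lambda>t. gibbs_entropy \<G> (\<lambda>G. P G + t * d G))"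
  have d0: "(\<Sum>G\<in>\<G>. d G) = 0" using mic1 P by (simp add: d_def sum_subtractf prob_dist_on_def)
  have mean_mic: "(\<Sum>G\<in>\<G>. mic G * C G i) = c i" if "i \<in> I" for i
  proof -
    have "(\<Sum>G\<in>S. C G i) = (\<Sum>G\<in>S. c i)"
      using that by (intro sum.cong) (auto simp: S_def satisfying_def)
    then show ?thesis using N by (simp add: sum_mic) (simp add: N_def)
  qed
  \<comment> \<open>Radius within which the perturbation stays nonnegative: on \<open>S\<close>
    because \<open>\<bar>d G\<bar> \<le> 1\<close>, off \<open>S\<close> because it multiplies
    \<open>P G\<close> by \<open>1 - t\<close>.\<close>
  define \<epsilon> where "\<epsilon> = min 1 (Min (P ` S))"
  have \<epsilon>: "0 < \<epsilon>" "\<epsilon> \<le> 1" "\<And>G. G \<in> S \<Longrightarrow> \<epsilon> \<le> P G"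
    using S Ppos by (auto simp: \<epsilon>_def min_le_iff_disj)
  have "\<phi> t \<le> \<phi> 0" if "\<bar>0 - t\<bar> < \<epsilon>" for t
  proof -
    have "0 \<le> P G + t * d G" if G: "G \<in> \<G>" for G
    proof (cases "G \<in> S")
      case True
      have "\<bar>t * d G\<bar> \<le> \<epsilon> * 1" unfolding abs_mult
        using \<open>\<bar>0 - t\<bar> < \<epsilon>\<close> mic01[of G] P01[OF G] by (intro mult_mono) (auto simp: d_def)
      then show ?thesis using \<epsilon>(3)[OF True] by linarith
    next
      case False
      then have "P G + t * d G = (1 - t) * P G" by (simp add: d_def mic algebra_simps)
      then show ?thesis using P01[OF G] \<open>\<bar>0 - t\<bar> < \<epsilon>\<close> \<epsilon> by simp
    qed
    then have "prob_dist_on \<G> (\<lambda>G. P G + t * d G)"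
      using P d0 by (simp add: prob_dist_on_def sum.distrib flip: sum_distrib_left)
    moreover have "mean_constraint \<G> I C c (\<lambda>G. P G + t * d G)"
      unfolding mean_constraint_def
    proof
      fix i assume i: "i \<in> I"
      have "(\<Sum>G\<in>\<G>. (P G + t * d G) * C G i) = (\<Sum>G\<in>\<G>. P G * C G i) + t * ((\<Sum>G\<in>\<G>. mic G * C G i) - (\<Sum>G\<in>\<G>. P G * C G i))"
        by (simp add: d_def algebra_simps sum.distrib sum_subtractf sum_distrib_left)
      then show "(\<Sum>G\<in>\<G>. (P G + t * d G) * C G i) = c i"
        using mean mean_mic[OF i] i by (simp add: mean_constraint_def)
    qed
    ultimately show ?thesis using max by (simp add: \<phi>_def)
  qed
  moreover have "(\<phi> has_real_derivative - (\<Sum>G\<in>\<G>. d G * ln (P G) + d G)) (at 0)"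
    unfolding \<phi>_def gibbs_entropy_def
  proof (intro DERIV_minus DERIV_sum)
    fix G assume G: "G \<in> \<G>"
    show "((\<lambda>t. (P G + t * d G) * ln (P G + t * d G)) has_real_derivative d G * ln (P G) + d G) (at 0)"
    \<comment> \<open>Where \<open>P\<close> vanishes so does \<open>d\<close>, hence the
      singularity of \<open>x * ln x\<close> at 0 is never met.\<close>
    proof (cases "P G = 0")
      case True
      then have "G \<notin> S" using Ppos[of G] by auto
      then have "d G = 0" by (simp add: d_def mic True)
      then show ?thesis using True by simp
    next
      case False
      then have "0 < P G" using P01[OF G] by simp
      then show ?thesis by (auto intro!: derivative_eq_intros)
    qed
  qed
  ultimately have "- (\<Sum>G\<in>\<G>. d G * ln (P G) + d G) = 0"
    using \<epsilon>(1) by (intro DERIV_local_max[of \<phi> _ 0 \<epsilon>]) auto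
  then have "(\<Sum>G\<in>\<G>. d G * ln (P G)) = 0" using d0 by (simp add: sum.distrib)
  \<comment> \<open>Stationarity: \<open>ln (P G)\<close> has the same mean under both ensembles, so
    the cross-entropy is the entropy of \<open>P\<close>.\<close>
  then have "(\<Sum>G\<in>\<G>. mic G * ln (P G)) = (\<Sum>G\<in>\<G>. P G * ln (P G))"
    by (simp add: d_def left_diff_distrib sum_subtractf)
  then have stat: "(\<Sum>G\<in>S. ln (P G)) / N = - gibbs_entropy \<G> P"
    by (simp add: sum_mic gibbs_entropy_def)
  have "relative_entropy \<G> mic P = (\<Sum>G\<in>S. ln (mic G / P G)) / N"
    unfolding relative_entropy_def by (rule sum_mic)
  also have "(\<Sum>G\<in>S. ln (mic G / P G)) = (\<Sum>G\<in>S. - ln N - ln (P G))"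
  proof (intro sum.cong refl)
    fix G assume G: "G \<in> S"
    have "ln (1 / N / P G) = ln (1 / N) - ln (P G)" using N Ppos[OF G] by (intro ln_divide_pos) auto
    then show "ln (mic G / P G) = - ln N - ln (P G)" using N G by (simp add: mic ln_div)
  qed
  also have "\<dots> / N = - ln N - (\<Sum>G\<in>S. ln (P G)) / N"
    using N by (simp add: sum_subtractf diff_divide_distrib) (simp add: N_def)
  finally show ?thesis unfolding stat by (simp add: mic_def N_def S_def)
qed

section \<open>Bipartite graphs with prescribed degrees\<close>

definition graph_of :: "('v \<times> 'v) set \<Rightarrow> 'v set set" where
  "graph_of R = (\<lambda>(i, j). {i, j}) ` R"

definition degree_mset :: "'v set \<Rightarrow> ('v \<Rightarrow> nat) \<Rightarrow> 'v multiset" where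
  "degree_mset V k = (\<Sum>i\<in>V. replicate_mset (k i) i)"

lemma count_degree_mset: "finite V \<Longrightarrow> count (degree_mset V k) i = (if i \<in> V then k i else 0)"
  by (simp add: degree_mset_def count_sum sum.delta)

lemma size_degree_mset: "size (degree_mset V k) = (\<Sum>i\<in>V. k i)"
  by (simp add: degree_mset_def)

lemma set_degree_mset: "finite V \<Longrightarrow> set_mset (degree_mset V k) \<subseteq> V"
  by (auto simp: count_degree_mset simp flip: count_greater_zero_iff split: if_splits)

text \<open>The multinomial coefficient, in product form to avoid division of natural
  numbers.\<close>

lemma card_permutations_of_degree_mset:
  assumes "finite V"
  shows "card (permutations_of_multiset (degree_mset V k)) * (\<Prod>i\<in>V. fact (k i)) = fact (\<Sum>i\<in>V. k i)"
proof -
  have "(\<Prod>i\<in>set_mset (degree_mset V k). fact (count (degree_mset V k) i)) = (\<Prod>i\<in>V. fact (k i) :: nat)"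
    using assms set_degree_mset[OF assms, of k]
    by (intro prod.mono_neutral_cong_left)
       (auto simp: count_degree_mset simp flip: count_greater_zero_iff)
  then show ?thesis
    using card_permutations_of_multiset_aux[of "degree_mset V k"] by (simp add: size_degree_mset)
qed

lemma ln_card_permutations_of_degree_mset:
  assumes "finite V"
  shows "ln (real (card (permutations_of_multiset (degree_mset V k))))
    = ln (fact (\<Sum>i\<in>V. k i)) - (\<Sum>i\<in>V. ln (fact (k i)))"
proof -
  have "fact (\<Sum>i\<in>V. k i) = real (card (permutations_of_multiset (degree_mset V k))) * (\<Prod>i\<in>V. fact (k i))"
    using arg_cong[OF card_permutations_of_degree_mset[OF assms], of real] by simp
  moreover have "ln (\<Prod>i\<in>V. fact (k i) :: real) = (\<Sum>i\<in>V. ln (fact (k i)))"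
    by (rule ln_prod) (use assms in auto)
  moreover have "0 < real (card (permutations_of_multiset (degree_mset V k)))"
    by (simp add: card_gt_0_iff)
  ultimately show ?thesis using assms by (simp add: ln_mult_pos prod_pos)
qed

locale bipartite_degrees =
  fixes V W :: "'v set" and k k' :: "'v \<Rightarrow> nat"
  assumes finite_V: "finite V" and finite_W: "finite W" and disjoint: "V \<inter> W = {}"
    and sum_eq: "(\<Sum>i\<in>V. k i) = (\<Sum>j\<in>W. k' j)"
begin

definition L :: nat where "L = (\<Sum>i\<in>V. k i)"

abbreviation "graphs \<equiv> bipartite_graphs V W"
abbreviation "sat \<equiv> satisfying graphs (V <+> W) (both_degrees V W) (both_targets k k')"
abbreviation "realising_sets \<equiv> realisations (degree_mset V k) (degree_mset W k')"

lemma mem_graph_of: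
  "R \<subseteq> V \<times> W \<Longrightarrow> i \<in> V \<Longrightarrow> j \<in> W \<Longrightarrow> {i, j} \<in> graph_of R \<longleftrightarrow> (i, j) \<in> R"
  using disjoint by (auto simp: graph_of_def doubleton_eq_iff image_iff)

text \<open>Disjoint layers give each edge a unique orientation from \<open>V\<close> to
  \<open>W\<close>, so graphs may be handled as subsets of \<open>V \<times> W\<close>.\<close>

lemma bij_betw_graph_of: "bij_betw graph_of (Pow (V \<times> W)) graphs"
proof (rule bij_betw_imageI)
  show "inj_on graph_of (Pow (V \<times> W))"
  proof (rule inj_onI)
    fix R R' assume *: "R \<in> Pow (V \<times> W)" "R' \<in> Pow (V \<times> W)" "graph_of R = graph_of R'"
    have "z \<in> R \<longleftrightarrow> z \<in> R'" for z
    proof (cases "z \<in> V \<times> W")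
      case True
      then obtain i j where "z = (i, j)" "i \<in> V" "j \<in> W" by auto
      then show ?thesis using * mem_graph_of[of R i j] mem_graph_of[of R' i j] by auto
    qed (use * in auto)
    then show "R = R'" by blast
  qed
  show "graph_of ` Pow (V \<times> W) = graphs"
  proof (intro equalityI subsetI)
    fix E assume "E \<in> graph_of ` Pow (V \<times> W)"
    then obtain R where R: "R \<subseteq> V \<times> W" "E = graph_of R" by auto
    have "simple_graph (V \<union> W) E"
      unfolding simple_graph_def
    proof
      fix e assume "e \<in> E"
      then obtain i j where "i \<in> V" "j \<in> W" "e = {i, j}" using R by (auto simp: graph_of_def)
      moreover have "i \<noteq> j" using calculation disjoint by blast
      ultimately show "\<exists>u\<in>V \<union> W. \<exists>v\<in>V \<union> W. u \<noteq> v \<and> e = {u, v}" by blast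
    qed
    moreover have "adj E i j = 0" if "i \<in> V \<and> j \<in> V \<or> i \<in> W \<and> j \<in> W" for i j
      using R disjoint that by (auto simp: adj_def graph_of_def doubleton_eq_iff)
    ultimately show "E \<in> graphs" unfolding bipartite_graphs_def by blast
  next
    fix E assume E: "E \<in> graphs"
    then have simple: "simple_graph (V \<union> W) E"
      and nonadj: "\<And>i j. i \<in> V \<and> j \<in> V \<or> i \<in> W \<and> j \<in> W \<Longrightarrow> adj E i j = 0"
      unfolding bipartite_graphs_def mem_Collect_eq by auto
    define R where "R = {(i, j). i \<in> V \<and> j \<in> W \<and> {i, j} \<in> E}"
    have "e \<in> graph_of R" if e: "e \<in> E" for e
    proof -
      obtain u v where uv: "u \<in> V \<union> W" "v \<in> V \<union> W" "e = {u, v}"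
        using simple e unfolding simple_graph_def by meson
      have "\<not> (u \<in> V \<and> v \<in> V \<or> u \<in> W \<and> v \<in> W)"
        using nonadj[of u v] e uv(3) by (auto simp: adj_def)
      then obtain i j where "i \<in> V" "j \<in> W" "e = {i, j}"
        using uv insert_commute[of u v "{}"] by blast
      then show ?thesis using e by (auto simp: graph_of_def R_def)
    qed
    moreover have "graph_of R \<subseteq> E" by (auto simp: graph_of_def R_def)
    ultimately have "E = graph_of R" by blast
    moreover have "R \<in> Pow (V \<times> W)" by (auto simp: R_def)
    ultimately show "E \<in> graph_of ` Pow (V \<times> W)" by blast
  qed
qed

lemma finite_graphs: "finite graphs"
  using bij_betw_finite[OF bij_betw_graph_of] finite_V finite_W by auto

lemma sum_graphs: "(\<Sum>E\<in>graphs. h E) = (\<Sum>R\<in>Pow (V \<times> W). h (graph_of R))"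
  by (rule sum.reindex_bij_betw[OF bij_betw_graph_of, symmetric])

lemma adj_graph_of: "R \<subseteq> V \<times> W \<Longrightarrow> i \<in> V \<Longrightarrow> j \<in> W \<Longrightarrow> adj (graph_of R) i j = of_bool ((i, j) \<in> R)"
  by (simp add: adj_def mem_graph_of)

lemma layer1_degree_graph_of:
  "R \<subseteq> V \<times> W \<Longrightarrow> i \<in> V \<Longrightarrow> layer1_degree W (graph_of R) i = (\<Sum>j\<in>W. of_bool ((i, j) \<in> R))"
  by (simp add: layer1_degree_def adj_graph_of)

lemma layer2_degree_graph_of:
  "R \<subseteq> V \<times> W \<Longrightarrow> j \<in> W \<Longrightarrow> layer2_degree V (graph_of R) j = (\<Sum>i\<in>V. of_bool ((i, j) \<in> R))"
  by (simp add: layer2_degree_def adj_graph_of)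

lemma finite_edge_set: "R \<subseteq> V \<times> W \<Longrightarrow> finite R"
  using finite_V finite_W finite_subset by blast

lemma count_fst:
  assumes R: "R \<subseteq> V \<times> W" and i: "i \<in> V"
  shows "count (image_mset fst (mset_set R)) i = layer1_degree W (graph_of R) i"
proof -
  have "count (image_mset fst (mset_set R)) i = card (fst -` {i} \<inter> R)"
    by (simp add: count_image_mset finite_edge_set[OF R])
  also have "fst -` {i} \<inter> R = Pair i ` {j \<in> W. (i, j) \<in> R}" using R by auto
  also have "card \<dots> = card {j \<in> W. (i, j) \<in> R}" by (rule card_image) (simp add: inj_on_def)
  also have "\<dots> = (\<Sum>j\<in>W. of_bool ((i, j) \<in> R))" using finite_W by (simp add: Int_def)
  finally show ?thesis by (simp add: layer1_degree_graph_of R i)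
qed

lemma count_snd:
  assumes R: "R \<subseteq> V \<times> W" and j: "j \<in> W"
  shows "count (image_mset snd (mset_set R)) j = layer2_degree V (graph_of R) j"
proof -
  have "count (image_mset snd (mset_set R)) j = card (snd -` {j} \<inter> R)"
    by (simp add: count_image_mset finite_edge_set[OF R])
  also have "snd -` {j} \<inter> R = (\<lambda>i. (i, j)) ` {i \<in> V. (i, j) \<in> R}" using R by auto
  also have "card \<dots> = card {i \<in> V. (i, j) \<in> R}" by (rule card_image) (simp add: inj_on_def)
  also have "\<dots> = (\<Sum>i\<in>V. of_bool ((i, j) \<in> R))" using finite_V by (simp add: Int_def)
  finally show ?thesis by (simp add: layer2_degree_graph_of R j)
qed

lemma realisations_iff:
  assumes R: "R \<subseteq> V \<times> W"
  shows "R \<in> realising_sets \<longleftrightarrow>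
    (\<forall>i\<in>V. layer1_degree W (graph_of R) i = k i) \<and> (\<forall>j\<in>W. layer2_degree V (graph_of R) j = k' j)"
proof -
  have "count (image_mset fst (mset_set R)) i = 0" if "i \<notin> V" for i
    using that R finite_edge_set[OF R] by (auto simp: count_eq_zero_iff)
  moreover have "count (image_mset snd (mset_set R)) j = 0" if "j \<notin> W" for j
    using that R finite_edge_set[OF R] by (auto simp: count_eq_zero_iff)
  ultimately show ?thesis
    using count_fst[OF R] count_snd[OF R] finite_edge_set[OF R]
    by (auto simp: realisations_def multiset_eq_iff count_degree_mset finite_V finite_W)
qed

lemma sat_iff: "E \<in> sat \<longleftrightarrow> E \<in> graphs \<and>
    (\<forall>i\<in>V. layer1_degree W E i = k i) \<and> (\<forall>j\<in>W. layer2_degree V E j = k' j)"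
  by (auto simp: satisfying_def Plus_def ball_Un both_degrees_def both_targets_def)

lemma card_sat: "card sat = card realising_sets"
proof -
  have sub: "realising_sets \<subseteq> Pow (V \<times> W)"
    using realisations_subset_Pow set_degree_mset[OF finite_V, of k] set_degree_mset[OF finite_W, of k'] by fastforce
  have "sat = graph_of ` realising_sets"
  proof (intro equalityI subsetI)
    fix E assume E: "E \<in> sat"
    then have "E \<in> graph_of ` Pow (V \<times> W)"
      using bij_betw_graph_of by (simp add: sat_iff bij_betw_def)
    then obtain R where R: "R \<subseteq> V \<times> W" "E = graph_of R" by blast
    moreover have "R \<in> realising_sets"
      using E R by (subst realisations_iff) (simp_all add: sat_iff)
    ultimately show "E \<in> graph_of ` realising_sets" by blast
  next
    fix E assume "E \<in> graph_of ` realising_sets"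
    then obtain R where R: "R \<in> realising_sets" "E = graph_of R" by auto
    then have "R \<subseteq> V \<times> W" using sub by auto
    then have "E \<in> graphs" using R bij_betw_graph_of by (auto simp: bij_betw_def)
    then show "E \<in> sat" using R realisations_iff[OF \<open>R \<subseteq> V \<times> W\<close>] by (simp add: sat_iff)
  qed
  moreover have "inj_on graph_of realising_sets"
    using bij_betw_graph_of sub inj_on_subset by (auto simp: bij_betw_def)
  ultimately show ?thesis by (simp add: card_image)
qed

text \<open>Logarithm of the number of matchings of the half-edges, \<open>L!\<close>, divided by
  the relabellings of the half-edges at each node.\<close>

definition log_count :: real where
  "log_count = ln (fact L) - (\<Sum>i\<in>V. ln (fact (k i))) - (\<Sum>j\<in>W. ln (fact (k' j)))"

lemma ln_card_permutations:
  "ln (real (card (permutations_of_multiset (degree_mset V k))) * real (card (permutations_of_multiset (degree_mset W k'))))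
   = log_count + ln (fact L)"
  by (subst ln_mult_pos)
     (simp_all add: card_gt_0_iff ln_card_permutations_of_degree_mset finite_V finite_W log_count_def L_def sum_eq[symmetric])

lemma ln_card_sat_le:
  assumes "sat \<noteq> {}"
  shows "ln (real (card sat)) \<le> log_count"
proof -
  have "finite sat" using finite_graphs by (auto simp: satisfying_def)
  then have pos: "0 < real (card sat)" using assms by (simp add: card_gt_0_iff)
  have "card realising_sets * fact L \<le>
      card (permutations_of_multiset (degree_mset V k)) * card (permutations_of_multiset (degree_mset W k'))"
    using card_realisations_le[of "degree_mset V k" "degree_mset W k'"]
    by (simp add: size_degree_mset sum_eq L_def)
  then have "real (card sat) * fact L \<le>
      real (card (permutations_of_multiset (degree_mset V k))) * real (card (permutations_of_multiset (degree_mset W k')))"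
    unfolding card_sat by (metis of_nat_fact of_nat_le_iff of_nat_mult)
  then have "ln (real (card sat) * fact L) \<le> log_count + ln (fact L)"
    unfolding ln_card_permutations[symmetric] using pos by (intro ln_mono) auto
  then show ?thesis using pos by (simp add: ln_mult_pos)
qed

lemma ln_card_sat_ge:
  assumes ne: "sat \<noteq> {}" and m: "\<And>i. i \<in> V \<Longrightarrow> k i \<le> m" "\<And>j. j \<in> W \<Longrightarrow> k' j \<le> m'"
    and L: "64 * (m * m') \<le> L"
  shows "log_count - 8 * (real m * real m') \<le> ln (real (card sat))"
proof -
  have "finite sat" using finite_graphs by (auto simp: satisfying_def)
  then have pos: "1 \<le> real (card sat)" using ne by (simp add: card_gt_0_iff Suc_le_eq)
  show ?thesis
  proof (cases "L = 0")
    \<comment> \<open>\<open>card_realisations_ge\<close> assumes at least one edge. Without edges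
      \<open>log_count\<close> is 0, and \<open>ln (card sat)\<close> is nonnegative.\<close>
    case True
    then have "\<forall>i\<in>V. k i = 0" "\<forall>j\<in>W. k' j = 0"
      using finite_V finite_W sum_eq by (auto simp: L_def)
    then have "log_count = 0" using True by (simp add: log_count_def)
    then show ?thesis using pos ln_ge_zero[OF pos]
      by (metis diff_ge_0_iff_ge diff_le_eq add_increasing2 mult_nonneg_nonneg of_nat_0_le_iff zero_le_numeral)
  next
    case False
    let ?X = "real (card (permutations_of_multiset (degree_mset V k))) * real (card (permutations_of_multiset (degree_mset W k')))"
    have X: "0 < ?X" by (simp add: card_gt_0_iff)
    have "exp (- (8 * (real m * real m'))) * ?X \<le> real (card realising_sets) * fact (size (degree_mset V k))"
      using False L m sum_eq unfolding L_def
      by (intro card_realisations_ge) (auto simp: size_degree_mset count_degree_mset finite_V finite_W simp del: sum_eq_0_iff)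
    then have "ln (exp (- (8 * (real m * real m'))) * ?X) \<le> ln (real (card sat) * fact L)"
      using X by (intro ln_mono) (auto simp: card_sat size_degree_mset L_def)
    then show ?thesis using pos X by (simp add: ln_mult_pos ln_card_permutations)
  qed
qed

end

section \<open>Entropy bounds\<close>

text \<open>Law of a random subset of \<open>A\<close> containing each \<open>z\<close>
  independently with probability \<open>q z\<close>.\<close>

definition bernoulli_weight :: "'a set \<Rightarrow> ('a \<Rightarrow> real) \<Rightarrow> 'a set \<Rightarrow> real" where
  "bernoulli_weight A q R = (\<Prod>z\<in>R. q z) * (\<Prod>z\<in>A - R. 1 - q z)"

lemma sum_bernoulli_weight: "finite A \<Longrightarrow> (\<Sum>R\<in>Pow A. bernoulli_weight A q R) = 1"
  using prod_add[of A q "\<lambda>z. 1 - q z"] by (simp add: bernoulli_weight_def)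

text \<open>Replacing the factor \<open>1 - q z\<close> by 0 kills exactly the subsets that miss
  \<open>z\<close>, and the remaining sum is again a product.\<close>

lemma sum_bernoulli_weight_marginal:
  assumes A: "finite A" and z: "z \<in> A"
  shows "(\<Sum>R\<in>Pow A. bernoulli_weight A q R * of_bool (z \<in> R)) = q z"
proof -
  define r where "r = (\<lambda>x. if x = z then 0 else 1 - q x)"
  have "bernoulli_weight A q R * of_bool (z \<in> R) = (\<Prod>x\<in>R. q x) * (\<Prod>x\<in>A - R. r x)" if "R \<subseteq> A" for R
  proof (cases "z \<in> R")
    case True
    then have "(\<Prod>x\<in>A - R. r x) = (\<Prod>x\<in>A - R. 1 - q x)" by (intro prod.cong) (auto simp: r_def)
    then show ?thesis using True by (simp add: bernoulli_weight_def)
  next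
    case False
    then have "(\<Prod>x\<in>A - R. r x) = 0" using A z by (intro prod_zero) (auto simp: r_def)
    then show ?thesis using False by simp
  qed
  then have "(\<Sum>R\<in>Pow A. bernoulli_weight A q R * of_bool (z \<in> R)) = (\<Prod>x\<in>A. q x + r x)"
    by (simp add: prod_add[OF A] cong: sum.cong_simp)
  also have "\<dots> = (q z + r z) * (\<Prod>x\<in>A - {z}. q x + r x)" using A z by (rule prod.remove)
  also have "(\<Prod>x\<in>A - {z}. q x + r x) = 1" by (rule prod.neutral) (simp add: r_def)
  finally show ?thesis by (simp add: r_def)
qed

text \<open>Linearity of expectation for a functional that is additive over the elements of
  \<open>R\<close>.\<close>

lemma sum_Pow_swap:
  assumes "finite A"
  shows "(\<Sum>R\<in>Pow A. P R * (\<Sum>z\<in>R. w z)) = (\<Sum>z\<in>A. (\<Sum>R\<in>Pow A. P R * of_bool (z \<in> R)) * (w z :: real))"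
proof -
  have "(\<Sum>z\<in>R. w z) = (\<Sum>z\<in>A. of_bool (z \<in> R) * w z)" if "R \<in> Pow A" for R
  proof -
    have "(\<Sum>z\<in>A. of_bool (z \<in> R) * w z) = (\<Sum>z\<in>R. of_bool (z \<in> R) * w z)"
      by (rule sum.mono_neutral_right) (use that assms in auto)
    then show ?thesis by simp
  qed
  then have "(\<Sum>R\<in>Pow A. P R * (\<Sum>z\<in>R. w z)) = (\<Sum>R\<in>Pow A. \<Sum>z\<in>A. P R * of_bool (z \<in> R) * w z)"
    by (intro sum.cong refl) (simp add: sum_distrib_left mult.assoc)
  also have "\<dots> = (\<Sum>z\<in>A. \<Sum>R\<in>Pow A. P R * of_bool (z \<in> R) * w z)" by (rule sum.swap)
  finally show ?thesis by (simp add: sum_distrib_right)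
qed

text \<open>On the support the logarithm of the weight is a constant plus a sum over
  \<open>R\<close>, so only the marginals \<open>q z\<close> enter.\<close>

lemma bernoulli_weight_entropy:
  assumes A: "finite A" and q: "\<And>z. z \<in> A \<Longrightarrow> 0 \<le> q z \<and> q z \<le> 1"
  shows "(\<Sum>R\<in>Pow A. bernoulli_weight A q R * ln (bernoulli_weight A q R))
     = (\<Sum>z\<in>A. q z * ln (q z) + (1 - q z) * ln (1 - q z))"
proof -
  let ?B = "bernoulli_weight A q"
  \<comment> \<open>For \<open>z\<close> in \<open>R\<close> the term \<open>ln (1 - q z)\<close>
    occurs with both signs, so its default value at \<open>q z = 1\<close> cancels.\<close>
  have "?B R * ln (?B R) = ?B R * (\<Sum>z\<in>R. ln (q z) - ln (1 - q z)) + ?B R * (\<Sum>z\<in>A. ln (1 - q z))"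
    if R: "R \<in> Pow A" for R
  proof (cases "?B R = 0")
    case False
    have fin: "finite R" "finite (A - R)" using R A finite_subset by auto
    have "q z \<noteq> 0" if "z \<in> R" for z using False that fin by (auto simp: bernoulli_weight_def)
    then have 1: "0 < q z" if "z \<in> R" for z using q[of z] R that by (force simp: order.order_iff_strict)
    have "1 - q z \<noteq> 0" if "z \<in> A - R" for z using False that fin by (auto simp: bernoulli_weight_def)
    then have 2: "0 < 1 - q z" if "z \<in> A - R" for z using q[of z] that by (force simp: order.order_iff_strict)
    have "ln (?B R) = ln (\<Prod>z\<in>R. q z) + ln (\<Prod>z\<in>A - R. 1 - q z)"
      unfolding bernoulli_weight_def using 1 2 by (intro ln_mult_pos prod_pos) auto
    also have "\<dots> = (\<Sum>z\<in>R. ln (q z)) + (\<Sum>z\<in>A - R. ln (1 - q z))"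
    proof (intro arg_cong2[where f = "(+)"])
      show "ln (\<Prod>z\<in>R. q z) = (\<Sum>z\<in>R. ln (q z))" by (rule ln_prod) (use 1 fin in force)+
      show "ln (\<Prod>z\<in>A - R. 1 - q z) = (\<Sum>z\<in>A - R. ln (1 - q z))" by (rule ln_prod) (use 2 fin in force)+
    qed
    also have "(\<Sum>z\<in>A - R. ln (1 - q z)) = (\<Sum>z\<in>A. ln (1 - q z)) - (\<Sum>z\<in>R. ln (1 - q z))"
      using A R by (intro sum_diff) auto
    finally have ln_B: "ln (?B R) = (\<Sum>z\<in>R. ln (q z)) + ((\<Sum>z\<in>A. ln (1 - q z)) - (\<Sum>z\<in>R. ln (1 - q z)))" .
    show ?thesis unfolding ln_B by (simp add: sum_subtractf algebra_simps)
  qed simp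
  then have "(\<Sum>R\<in>Pow A. ?B R * ln (?B R)) =
     (\<Sum>R\<in>Pow A. ?B R * (\<Sum>z\<in>R. ln (q z) - ln (1 - q z))) + (\<Sum>R\<in>Pow A. ?B R) * (\<Sum>z\<in>A. ln (1 - q z))"
    by (simp add: sum.distrib sum_distrib_right cong: sum.cong_simp)
  also have "(\<Sum>R\<in>Pow A. ?B R * (\<Sum>z\<in>R. ln (q z) - ln (1 - q z))) = (\<Sum>z\<in>A. q z * (ln (q z) - ln (1 - q z)))"
    unfolding sum_Pow_swap[OF A]
    by (intro sum.cong refl arg_cong2[where f = "(*)"] sum_bernoulli_weight_marginal A)
  finally show ?thesis
    by (simp add: sum_bernoulli_weight[OF A] algebra_simps sum.distrib sum_subtractf)
qed

text \<open>From \<open>ln (1 - q) \<le> - q\<close>. The term \<open>q^2\<close> is the source of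
  the loss \<open>m * m'\<close> in the lower entropy bound.\<close>

lemma neg_mult_ln_one_minus_ge: "(1 - q) * ln (1 - q) \<le> q\<^sup>2 - q" if "0 \<le> q" "q \<le> 1" for q :: real
proof (cases "q = 1")
  case False
  then have "ln (1 - q) \<le> - q" using that ln_le_minus_one[of "1 - q"] by simp
  then have "(1 - q) * ln (1 - q) \<le> (1 - q) * (- q)" using that by (intro mult_left_mono) auto
  then show ?thesis by (simp add: algebra_simps power2_eq_square)
qed simp

lemma stirling_g_eq: "stirling_g q = ln (fact q) - real q * ln (real q) + real q"
proof (cases "q = 0")
  case False
  then show ?thesis by (simp add: stirling_g_def ln_divide_pos ln_mult_pos ln_realpow)
qed (simp add: stirling_g_def)

section \<open>Entropy bounds from the edge probabilities \<open>k i * k' j / L\<close>\<close>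

context bipartite_degrees
begin

text \<open>The rank-one matrix with the prescribed row and column sums; for \<open>L = 0\<close>
  division by zero makes it vanish, as it should.\<close>

definition p :: "'v \<times> 'v \<Rightarrow> real" where
  "p = (\<lambda>(i, j). real (k i) * real (k' j) / real L)"

definition log_weight :: real where
  "log_weight = (\<Sum>i\<in>V. real (k i) * ln (real (k i))) + (\<Sum>j\<in>W. real (k' j) * ln (real (k' j))) - real L * ln (real L)"

definition marginal :: "('v set set \<Rightarrow> real) \<Rightarrow> 'v \<times> 'v \<Rightarrow> real" where
  "marginal P z = (\<Sum>R\<in>Pow (V \<times> W). P (graph_of R) * of_bool (z \<in> R))"

lemma finite_VW: "finite (V \<times> W)" using finite_V finite_W by simp

lemma sum_layer2: "(\<Sum>j\<in>W. k' j) = L" by (simp add: L_def sum_eq)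

lemma p_row_sum: "i \<in> V \<Longrightarrow> (\<Sum>j\<in>W. p (i, j)) = real (k i)"
proof -
  assume "i \<in> V"
  have "(\<Sum>j\<in>W. p (i, j)) = real (k i) * (\<Sum>j\<in>W. real (k' j)) / real L"
    by (simp add: p_def sum_distrib_left sum_divide_distrib)
  then show ?thesis using \<open>i \<in> V\<close> finite_V sum_layer2
    by (cases "L = 0") (auto simp: L_def simp flip: of_nat_sum)
qed

lemma p_col_sum: "j \<in> W \<Longrightarrow> (\<Sum>i\<in>V. p (i, j)) = real (k' j)"
proof -
  assume "j \<in> W"
  have "(\<Sum>i\<in>V. p (i, j)) = (\<Sum>i\<in>V. real (k i)) * real (k' j) / real L"
    by (simp add: p_def sum_distrib_right sum_divide_distrib)
  also have "(\<Sum>i\<in>V. real (k i)) = real L" by (simp add: L_def)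
  finally show ?thesis using \<open>j \<in> W\<close> finite_W sum_layer2
    by (cases "L = 0") auto
qed

lemma mean_constraint_iff:
  "mean_constraint graphs (V <+> W) (both_degrees V W) (both_targets k k') P \<longleftrightarrow>
    (\<forall>i\<in>V. (\<Sum>j\<in>W. marginal P (i, j)) = real (k i)) \<and> (\<forall>j\<in>W. (\<Sum>i\<in>V. marginal P (i, j)) = real (k' j))"
proof -
  have "(\<Sum>E\<in>graphs. P E * real (layer1_degree W E i)) = (\<Sum>j\<in>W. marginal P (i, j))" if "i \<in> V" for i
    unfolding sum_graphs marginal_def
    by (subst sum.swap, intro sum.cong refl)
       (use that in \<open>simp add: layer1_degree_graph_of sum_distrib_left[symmetric] del: sum_of_bool_eq\<close>)
  moreover have "(\<Sum>E\<in>graphs. P E * real (layer2_degree V E j)) = (\<Sum>i\<in>V. marginal P (i, j))" if "j \<in> W" for j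
    unfolding sum_graphs marginal_def
    by (subst sum.swap, intro sum.cong refl)
       (use that in \<open>simp add: layer2_degree_graph_of sum_distrib_left[symmetric] del: sum_of_bool_eq\<close>)
  ultimately show ?thesis
    by (auto simp: mean_constraint_def Plus_def ball_Un both_degrees_def both_targets_def)
qed

text \<open>Guarantees that the logarithm of \<open>p\<close> splits into genuine logarithms
  wherever it carries weight.\<close>

lemma marginal_imp_pos:
  assumes row: "\<And>i. i \<in> V \<Longrightarrow> (\<Sum>j\<in>W. \<mu> (i, j)) = real (k i)"
    and col: "\<And>j. j \<in> W \<Longrightarrow> (\<Sum>i\<in>V. \<mu> (i, j)) = real (k' j)"
    and nonneg: "\<And>z. 0 \<le> \<mu> z" and ij: "i \<in> V" "j \<in> W" "0 < \<mu> (i, j)"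
  shows "0 < k i" "0 < k' j" "0 < L"
proof -
  have "\<mu> (i, j) \<le> real (k i)"
    unfolding row[OF ij(1), symmetric] using nonneg finite_W ij by (intro member_le_sum) auto
  then show "0 < k i" using ij by (metis le_less_trans not_le of_nat_0_less_iff)
  then show "0 < L" unfolding L_def using finite_V ij by (intro sum_pos2) auto
  have "\<mu> (i, j) \<le> real (k' j)"
    unfolding col[OF ij(2), symmetric]
    using nonneg finite_V ij by (intro member_le_sum[of i V "\<lambda>i. \<mu> (i, j)"]) auto
  then show "0 < k' j" using ij by (metis le_less_trans not_le of_nat_0_less_iff)
qed

text \<open>\<open>ln (p (i, j))\<close> is a function of \<open>i\<close> plus a function of
  \<open>j\<close> plus a constant, so its mean depends only on row and column sums. The upper and
  lower entropy bounds therefore share one main term.\<close>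

lemma sum_marginal_ln_p:
  assumes row: "\<And>i. i \<in> V \<Longrightarrow> (\<Sum>j\<in>W. \<mu> (i, j)) = real (k i)"
    and col: "\<And>j. j \<in> W \<Longrightarrow> (\<Sum>i\<in>V. \<mu> (i, j)) = real (k' j)"
    and nonneg: "\<And>z. 0 \<le> \<mu> z"
  shows "(\<Sum>z\<in>V \<times> W. \<mu> z * ln (p z)) = log_weight"
proof -
  have *: "\<mu> (i, j) * ln (p (i, j)) = \<mu> (i, j) * ln (real (k i)) + \<mu> (i, j) * ln (real (k' j)) - \<mu> (i, j) * ln (real L)"
    if "i \<in> V" "j \<in> W" for i j
  proof (cases "\<mu> (i, j) = 0")
    case False
    then have "0 < \<mu> (i, j)" using nonneg[of "(i, j)"] by (simp add: order.order_iff_strict)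
    note pos = marginal_imp_pos[OF row col nonneg that this]
    then have "ln (p (i, j)) = ln (real (k i)) + ln (real (k' j)) - ln (real L)"
      unfolding p_def case_prod_conv by (simp add: ln_divide_pos ln_mult_pos)
    then show ?thesis by (simp only: distrib_left right_diff_distrib)
  qed simp
  have "(\<Sum>z\<in>V \<times> W. \<mu> z * ln (p z)) = (\<Sum>i\<in>V. \<Sum>j\<in>W. \<mu> (i, j) * ln (p (i, j)))"
    by (simp add: sum.cartesian_product)
  also have "\<dots> = (\<Sum>i\<in>V. \<Sum>j\<in>W. \<mu> (i, j) * ln (real (k i))) + (\<Sum>i\<in>V. \<Sum>j\<in>W. \<mu> (i, j) * ln (real (k' j)))
     - (\<Sum>i\<in>V. \<Sum>j\<in>W. \<mu> (i, j) * ln (real L))"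
    by (simp add: * sum.distrib sum_subtractf cong: sum.cong)
  also have "(\<Sum>i\<in>V. \<Sum>j\<in>W. \<mu> (i, j) * ln (real (k i))) = (\<Sum>i\<in>V. real (k i) * ln (real (k i)))"
    by (simp add: row flip: sum_distrib_right cong: sum.cong)
  also have "(\<Sum>i\<in>V. \<Sum>j\<in>W. \<mu> (i, j) * ln (real (k' j))) = (\<Sum>j\<in>W. real (k' j) * ln (real (k' j)))"
    by (subst sum.swap) (simp add: col flip: sum_distrib_right cong: sum.cong)
  also have "(\<Sum>i\<in>V. \<Sum>j\<in>W. \<mu> (i, j) * ln (real L)) = real L * ln (real L)"
    by (simp add: row L_def flip: sum_distrib_right cong: sum.cong)
  finally show ?thesis by (simp add: log_weight_def)
qed

lemma marginal_nonneg: "prob_dist_on graphs P \<Longrightarrow> 0 \<le> marginal P z"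
  using bij_betw_graph_of unfolding marginal_def prob_dist_on_def bij_betw_def
  by (intro sum_nonneg) auto

lemma sum_p: "(\<Sum>z\<in>V \<times> W. p z) = real L"
proof -
  have "(\<Sum>z\<in>V \<times> W. p z) = (\<Sum>i\<in>V. \<Sum>j\<in>W. p (i, j))" by (simp add: sum.cartesian_product)
  then show ?thesis by (simp add: p_row_sum L_def cong: sum.cong)
qed

lemma p_nonneg: "0 \<le> p z" by (simp add: p_def split: prod.split)

text \<open>Gibbs' inequality against the unnormalised weight \<open>R \<mapsto> \<Prod>z\<in>R. p z\<close>, whose total mass
  \<open>\<Prod>z. 1 + p z\<close> is at most \<open>exp L\<close>.\<close>

lemma gibbs_entropy_upper:
  assumes P: "prob_dist_on graphs P"
    and mean: "mean_constraint graphs (V <+> W) (both_degrees V W) (both_targets k k') P"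
  shows "gibbs_entropy graphs P \<le> real L - log_weight"
proof -
  define P' where "P' = (\<lambda>R. P (graph_of R))"
  define Q where "Q = (\<lambda>R. exp (- real L) * (\<Prod>z\<in>R. p z))"
  have row: "\<And>i. i \<in> V \<Longrightarrow> (\<Sum>j\<in>W. marginal P (i, j)) = real (k i)"
    and col: "\<And>j. j \<in> W \<Longrightarrow> (\<Sum>i\<in>V. marginal P (i, j)) = real (k' j)"
    using mean unfolding mean_constraint_iff by auto
  note nonneg = marginal_nonneg[OF P]
  have P': "prob_dist_on (Pow (V \<times> W)) P'"
    using P bij_betw_graph_of by (auto simp: prob_dist_on_def P'_def sum_graphs bij_betw_def)
  \<comment> \<open>An edge present with positive probability has a positive marginal, so
    \<open>Q\<close> is positive wherever \<open>P'\<close> is.\<close>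
  have pos: "0 < p z" if "R \<subseteq> V \<times> W" "0 < P' R" "z \<in> R" for R z
  proof -
    have "z \<in> V \<times> W" using that by blast
    then obtain i j where z: "z = (i, j)" "i \<in> V" "j \<in> W" by blast
    have "P' R * of_bool (z \<in> R) \<le> marginal P z"
      unfolding marginal_def P'_def
      by (rule member_le_sum[of R "Pow (V \<times> W)" "\<lambda>R. P (graph_of R) * of_bool (z \<in> R)"])
         (use that P' finite_VW in \<open>auto simp: prob_dist_on_def P'_def\<close>)
    then have "0 < marginal P (i, j)" using that z by simp
    from marginal_imp_pos[OF row col nonneg z(2,3) this] show ?thesis
      by (simp add: p_def z)
  qed
  have "gibbs_entropy (Pow (V \<times> W)) P' \<le> - (\<Sum>R\<in>Pow (V \<times> W). P' R * ln (Q R))"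
  proof (rule gibbs_entropy_le)
    show "finite (Pow (V \<times> W))" using finite_VW by simp
    have "(\<Sum>R\<in>Pow (V \<times> W). Q R) = exp (- real L) * (\<Prod>z\<in>V \<times> W. p z + 1)"
      by (simp add: Q_def prod_add[OF finite_VW] sum_distrib_left)
    also have "(\<Prod>z\<in>V \<times> W. p z + 1) \<le> (\<Prod>z\<in>V \<times> W. exp (p z))"
      using p_nonneg exp_ge_add_one_self by (intro prod_mono) (auto simp: add.commute add_nonneg_nonneg)
    also have "(\<Prod>z\<in>V \<times> W. exp (p z)) = exp (real L)"
      using finite_VW by (simp add: sum_p flip: exp_sum)
    finally show "(\<Sum>R\<in>Pow (V \<times> W). Q R) \<le> 1" by (simp flip: exp_add)
    show "0 \<le> Q R" for R by (simp add: Q_def prod_nonneg p_nonneg)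
    show "0 < Q R" if "R \<in> Pow (V \<times> W)" "0 < P' R" for R
      using pos that unfolding Q_def by (intro mult_pos_pos prod_pos) auto
  qed (rule P')
  also have "(\<Sum>R\<in>Pow (V \<times> W). P' R * ln (Q R)) = (\<Sum>R\<in>Pow (V \<times> W). P' R * (\<Sum>z\<in>R. ln (p z)) - P' R * real L)"
  proof (intro sum.cong refl)
    fix R assume R: "R \<in> Pow (V \<times> W)"
    show "P' R * ln (Q R) = P' R * (\<Sum>z\<in>R. ln (p z)) - P' R * real L"
    proof (cases "P' R = 0")
      case False
      then have p0: "0 < p z" if "z \<in> R" for z
        using that pos[of R z] P' R by (auto simp: prob_dist_on_def order.order_iff_strict)
      then have "ln (Q R) = - real L + ln (\<Prod>z\<in>R. p z)"
        unfolding Q_def by (subst ln_mult_pos) (auto intro: prod_pos)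
      also have "ln (\<Prod>z\<in>R. p z) = (\<Sum>z\<in>R. ln (p z))"
        by (rule ln_prod) (use p0 R finite_edge_set in force)+
      finally have ln_Q: "ln (Q R) = - real L + (\<Sum>z\<in>R. ln (p z))" .
      show ?thesis unfolding ln_Q by (simp add: algebra_simps)
    qed simp
  qed
  also have "\<dots> = (\<Sum>z\<in>V \<times> W. marginal P z * ln (p z)) - real L"
    using P' unfolding sum_subtractf sum_Pow_swap[OF finite_VW]
    by (simp add: prob_dist_on_def marginal_def P'_def flip: sum_distrib_right)
  also have "\<dots> = log_weight - real L" using sum_marginal_ln_p[OF row col nonneg] by simp
  finally show ?thesis by (simp add: gibbs_entropy_def sum_graphs P'_def)
qed

text \<open>Independent edges with probabilities \<open>p\<close> meet the constraint on average, so
  the maximiser has at least their entropy.\<close>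

lemma canonical_entropy_lower:
  assumes can: "is_degree_canonical V W k k' P"
    and m: "\<And>i. i \<in> V \<Longrightarrow> k i \<le> m" "\<And>j. j \<in> W \<Longrightarrow> k' j \<le> m'" and L: "m * m' \<le> L"
  shows "real L - log_weight - real m * real m' \<le> gibbs_entropy graphs P"
proof -
  define g where "g = inv_into (Pow (V \<times> W)) graph_of"
  have g: "g (graph_of R) = R" if "R \<in> Pow (V \<times> W)" for R
    using that bij_betw_graph_of by (simp add: g_def bij_betw_def)
  define B where "B = bernoulli_weight (V \<times> W) p"
  define Q where "Q = (\<lambda>E. B (g E))"
  have Q: "Q (graph_of R) = B R" if "R \<in> Pow (V \<times> W)" for R using g that by (simp add: Q_def)
  have p_le: "p z \<le> real m * real m' / real L" if "z \<in> V \<times> W" for z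
    using that m by (auto simp: p_def intro!: divide_right_mono mult_mono)
  have p01: "0 \<le> p z \<and> p z \<le> 1" if "z \<in> V \<times> W" for z
  proof -
    \<comment> \<open>Here \<open>m * m' \<le> L\<close> makes the entries of \<open>p\<close>
      probabilities.\<close>
    have "real m * real m' \<le> real L" using L by (metis of_nat_le_iff of_nat_mult)
    then have "real m * real m' / real L \<le> 1" by (cases "L = 0") (simp_all add: divide_le_eq_1)
    then show ?thesis using p_le[OF that] p_nonneg by auto
  qed
  have "prob_dist_on graphs Q"
  proof -
    have "0 \<le> B R" if "R \<in> Pow (V \<times> W)" for R
      unfolding B_def bernoulli_weight_def using that p01 by (intro mult_nonneg_nonneg prod_nonneg) auto
    moreover have "(\<Sum>R\<in>Pow (V \<times> W). B R) = 1" unfolding B_def by (rule sum_bernoulli_weight[OF finite_VW])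
    moreover have "graphs = graph_of ` Pow (V \<times> W)" using bij_betw_graph_of by (simp add: bij_betw_def)
    ultimately show ?thesis using Q unfolding prob_dist_on_def sum_graphs by (simp cong: sum.cong_simp)
  qed
  moreover have "marginal Q z = p z" if "z \<in> V \<times> W" for z
    using sum_bernoulli_weight_marginal[OF finite_VW that, of p]
    by (simp add: marginal_def Q B_def cong: sum.cong_simp)
  then have "mean_constraint graphs (V <+> W) (both_degrees V W) (both_targets k k') Q"
    unfolding mean_constraint_iff by (simp add: p_row_sum p_col_sum cong: sum.cong)
  ultimately have "gibbs_entropy graphs Q \<le> gibbs_entropy graphs P"
    using can by (simp add: is_degree_canonical_def is_canonical_def)
  moreover have "gibbs_entropy graphs Q = - (\<Sum>z\<in>V \<times> W. p z * ln (p z) + (1 - p z) * ln (1 - p z))"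
    using bernoulli_weight_entropy[OF finite_VW p01]
    by (simp add: gibbs_entropy_def sum_graphs Q B_def cong: sum.cong_simp)
  moreover have "(\<Sum>z\<in>V \<times> W. p z * ln (p z) + (1 - p z) * ln (1 - p z))
     \<le> (\<Sum>z\<in>V \<times> W. p z * ln (p z) + (p z * (real m * real m' / real L) - p z))"
  proof (rule sum_mono)
    fix z assume z: "z \<in> V \<times> W"
    \<comment> \<open>One factor is bounded by \<open>m * m' / L\<close>; since the other sums to
      \<open>L\<close>, the total loss is at most \<open>m * m'\<close>.\<close>
    have "(p z)\<^sup>2 \<le> p z * (real m * real m' / real L)"
      unfolding power2_eq_square using p_le[OF z] p_nonneg by (rule mult_left_mono)
    then show "p z * ln (p z) + (1 - p z) * ln (1 - p z) \<le> p z * ln (p z) + (p z * (real m * real m' / real L) - p z)"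
      using neg_mult_ln_one_minus_ge[of "p z"] p01[OF z] by simp
  qed
  moreover have "\<dots> = log_weight + (real L * (real m * real m' / real L) - real L)"
    unfolding sum.distrib sum_subtractf
    by (simp add: sum_marginal_ln_p p_row_sum p_col_sum p_nonneg sum_p flip: sum_distrib_right sum_divide_distrib)
  moreover have "real L * (real m * real m' / real L) \<le> real m * real m'" by simp
  ultimately show ?thesis by linarith
qed

text \<open>The entropy lies at most \<open>m * m'\<close> below \<open>L - log_weight\<close>, and
  \<open>ln (card sat)\<close> at most \<open>8 * m * m'\<close> below \<open>log_count\<close>. The
  two main terms differ by the Stirling corrections of all degrees minus that of
  \<open>L\<close>.\<close>

lemma relative_entropy_bounds:
  assumes can: "is_degree_canonical V W k k' P" and ne: "sat \<noteq> {}"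
    and m: "\<And>i. i \<in> V \<Longrightarrow> k i \<le> m" "\<And>j. j \<in> W \<Longrightarrow> k' j \<le> m'" and L: "64 * (m * m') \<le> L"
  shows "\<bar>relative_entropy graphs (degree_microcanonical V W k k') P
      - ((\<Sum>i\<in>V. stirling_g (k i)) + (\<Sum>j\<in>W. stirling_g (k' j)))\<bar>
    \<le> \<bar>stirling_g L\<bar> + 8 * (real m * real m')"
proof -
  have S: "relative_entropy graphs (degree_microcanonical V W k k') P = gibbs_entropy graphs P - ln (real (card sat))"
    using relative_entropy_microcanonical[OF finite_graphs _ ne] can
    by (simp add: degree_microcanonical_def is_degree_canonical_def)
  have "gibbs_entropy graphs P \<le> real L - log_weight"
    using can by (intro gibbs_entropy_upper) (auto simp: is_degree_canonical_def is_canonical_def)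
  moreover have "real L - log_weight - real m * real m' \<le> gibbs_entropy graphs P"
    using L by (intro canonical_entropy_lower[OF can m]) auto
  moreover have "real L - log_weight - log_count = (\<Sum>i\<in>V. stirling_g (k i)) + (\<Sum>j\<in>W. stirling_g (k' j)) - stirling_g L"
  proof -
    have "(\<Sum>i\<in>V. real (k i)) = real L" "(\<Sum>j\<in>W. real (k' j)) = real L"
      using sum_layer2 by (simp_all add: L_def flip: of_nat_sum)
    then show ?thesis
      by (simp add: stirling_g_eq log_weight_def log_count_def sum.distrib sum_subtractf)
  qed
  moreover have "log_count - 8 * (real m * real m') \<le> ln (real (card sat))" by (rule ln_card_sat_ge[OF ne m L])
  moreover have "ln (real (card sat)) \<le> log_count" by (rule ln_card_sat_le[OF ne])
  moreover have "0 \<le> real m * real m'" by simp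
  ultimately show ?thesis unfolding S by linarith
qed

end

section \<open>Limits\<close>

lemma stirling_g_nonneg: "0 \<le> stirling_g q"
proof -
  have "real q ^ q / fact q \<le> exp (real q)"
  proof -
    \<comment> \<open>A single term of the exponential series at \<open>q\<close> is at most the
      whole series.\<close>
    have "(\<Sum>i\<in>{q}. real q ^ i / fact i) \<le> (\<Sum>i. real q ^ i / fact i)"
      using summable_exp[of "real q"] by (intro sum_le_suminf) (auto simp: divide_inverse mult.commute)
    also have "\<dots> = exp (real q)" by (simp add: exp_def scaleR_conv_of_real divide_inverse mult.commute)
    finally show ?thesis by simp
  qed
  then have "real q ^ q * exp (- real q) \<le> fact q" by (simp add: exp_minus field_simps)
  moreover have "0 < real q ^ q * exp (- real q)" by (cases "q = 0") auto
  ultimately show ?thesis by (simp add: stirling_g_def)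
qed

text \<open>Induction: \<open>exp 1 \<le> (1 + 1 / q) ^ (q + 1)\<close> makes the ratio of
  consecutive right-hand sides at least \<open>q + 1\<close>.\<close>

lemma fact_le_stirling: "1 \<le> q \<Longrightarrow> fact q \<le> exp 1 * real q * (real q ^ q * exp (- real q))"
proof (induction q rule: nat_induct_at_least)
  case (Suc q)
  have q: "0 < real q" using Suc by simp
  have key: "exp 1 \<le> ((real q + 1) / real q) ^ Suc q"
  proof -
    have "ln (real q / (real q + 1)) \<le> real q / (real q + 1) - 1" using q by (intro ln_le_minus_one) auto
    also have "\<dots> = - (1 / (real q + 1))" using q by (simp add: field_simps)
    finally have "1 \<le> real (Suc q) * ln ((real q + 1) / real q)"
      using q by (simp add: ln_divide_pos field_simps)
    then have "exp 1 \<le> exp (real (Suc q) * ln ((real q + 1) / real q))" by simp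
    also have "\<dots> = ((real q + 1) / real q) ^ Suc q" using q by (simp only: exp_of_nat_mult) simp
    finally show ?thesis .
  qed
  have "fact (Suc q) = (real q + 1) * (fact q :: real)" by (simp add: add.commute)
  also have "\<dots> \<le> (real q + 1) * (exp 1 * real q * (real q ^ q * exp (- real q)))"
    using Suc by (intro mult_left_mono) auto
  also have "\<dots> = (real q + 1) * exp (- real q) * (real q ^ Suc q * exp 1)" by simp
  also have "\<dots> \<le> (real q + 1) * exp (- real q) * (real q ^ Suc q * ((real q + 1) / real q) ^ Suc q)"
    by (intro mult_left_mono key) auto
  also have "real q ^ Suc q * ((real q + 1) / real q) ^ Suc q = (real q + 1) ^ Suc q"
    using q by (simp only: power_mult_distrib[symmetric]) simp
  also have "exp (- real q) = exp 1 * exp (- real (Suc q))" by (simp flip: exp_add)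
  finally show ?case by (simp add: mult_ac add.commute)
qed (simp flip: exp_add)

lemma stirling_g_le: "1 \<le> q \<Longrightarrow> stirling_g q \<le> 1 + ln (real q)"
proof -
  assume q: "1 \<le> q"
  then have pos: "0 < real q ^ q * exp (- real q)" by simp
  then have "fact q / (real q ^ q * exp (- real q)) \<le> exp 1 * real q"
    using fact_le_stirling[OF q] by (simp add: pos_divide_le_eq)
  then have "stirling_g q \<le> ln (exp 1 * real q)"
    unfolding stirling_g_def using q pos by (intro ln_mono) auto
  then show ?thesis using q by (simp add: ln_mult_pos)
qed

section \<open>The weighted norm of degree distributions\<close>

lemma l1g_norm_nonneg: "0 \<le> l1g_norm h"
  unfolding l1g_norm_def by (intro suminf_nonneg summable_ereal_pos) (auto simp: stirling_g_nonneg)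

text \<open>Additive form, because differences of possibly infinite extended reals are awkward; used
  in both directions it acts as the reverse triangle inequality.\<close>

lemma l1g_norm_triangle: "l1g_norm h \<le> l1g_norm h' + l1g_norm (\<lambda>q. h q - h' q)"
proof -
  have pos: "0 \<le> ereal (\<bar>f q\<bar> * stirling_g q)" for f q by (simp add: stirling_g_nonneg)
  have "l1g_norm h \<le> (\<Sum>q. ereal (\<bar>h' q\<bar> * stirling_g q) + ereal (\<bar>h q - h' q\<bar> * stirling_g q))"
    unfolding l1g_norm_def
  proof (rule suminf_le_pos[OF _ pos])
    fix q
    have "\<bar>h q\<bar> * stirling_g q \<le> (\<bar>h' q\<bar> + \<bar>h q - h' q\<bar>) * stirling_g q"
      using stirling_g_nonneg[of q] by (intro mult_right_mono) auto
    then show "ereal (\<bar>h q\<bar> * stirling_g q) \<le> ereal (\<bar>h' q\<bar> * stirling_g q) + ereal (\<bar>h q - h' q\<bar> * stirling_g q)"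
      by (simp add: algebra_simps)
  qed
  also have "\<dots> = l1g_norm h' + l1g_norm (\<lambda>q. h q - h' q)"
    unfolding l1g_norm_def by (rule suminf_add_ereal) (use pos in auto)
  finally show ?thesis .
qed

lemma l1g_norm_minus_commute: "l1g_norm (\<lambda>q. h q - h' q) = l1g_norm (\<lambda>q. h' q - h q)"
  by (simp add: l1g_norm_def abs_minus_commute)

text \<open>Links the main term of the relative entropy, an average over nodes, to the norm. Only
  the finitely many attained degrees contribute, and the two sums are exchanged.\<close>

lemma l1g_norm_empirical:
  assumes V: "finite V"
  shows "l1g_norm (empirical V k) = ereal ((\<Sum>i\<in>V. stirling_g (k i)) / real (card V))"
proof -
  have "empirical V k q = 0" if "q \<notin> k ` V" for q
    using that by (auto simp: empirical_def indicator_def intro!: sum.neutral)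
  then have "l1g_norm (empirical V k) = (\<Sum>q\<in>k ` V. ereal (\<bar>empirical V k q\<bar> * stirling_g q))"
    unfolding l1g_norm_def by (intro suminf_finite) (use V in auto)
  also have "\<dots> = ereal (\<Sum>q\<in>k ` V. \<bar>empirical V k q\<bar> * stirling_g q)" by simp
  also have "(\<Sum>q\<in>k ` V. \<bar>empirical V k q\<bar> * stirling_g q)
      = (\<Sum>q\<in>k ` V. \<Sum>i\<in>V. indicator {k i} q * stirling_g q / real (card V))"
    by (intro sum.cong refl)
       (simp add: empirical_def sum_nonneg sum_distrib_right sum_divide_distrib)
  also have "\<dots> = (\<Sum>i\<in>V. \<Sum>q\<in>k ` V. indicator {k i} q * stirling_g q / real (card V))" by (rule sum.swap)
  also have "\<dots> = (\<Sum>i\<in>V. stirling_g (k i) / real (card V))"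
  proof (intro sum.cong refl)
    fix i assume "i \<in> V"
    then show "(\<Sum>q\<in>k ` V. indicator {k i} q * stirling_g q / real (card V)) = stirling_g (k i) / real (card V)"
      using V by (subst sum.remove[of _ "k i"]) (auto simp: indicator_def intro!: sum.neutral)
  qed
  finally show ?thesis by (simp add: sum_divide_distrib)
qed

text \<open>One index with distance below 1 makes the norm of \<open>f\<close> finite, as the
  empirical norm is real; the two triangle inequalities then give convergence.\<close>

lemma l1g_norm_limit:
  assumes V: "\<And>n. finite (V n)" and lim: "(\<lambda>n. l1g_norm (\<lambda>q. empirical (V n) (k n) q - f q)) \<longlonglongrightarrow> 0"
  obtains F where "l1g_norm f = ereal F"
    "(\<lambda>n. (\<Sum>i\<in>V n. stirling_g (k n i)) / real (card (V n))) \<longlonglongrightarrow> F"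
proof -
  define e where "e = (\<lambda>n. l1g_norm (\<lambda>q. empirical (V n) (k n) q - f q))"
  define a where "a = (\<lambda>n. (\<Sum>i\<in>V n. stirling_g (k n i)) / real (card (V n)))"
  have le1: "l1g_norm f \<le> ereal (a n) + e n" for n
    using l1g_norm_triangle[of f "empirical (V n) (k n)"] V
    by (simp add: a_def e_def l1g_norm_empirical l1g_norm_minus_commute[of f])
  have le2: "ereal (a n) \<le> l1g_norm f + e n" for n
    using l1g_norm_triangle[of "empirical (V n) (k n)" f] V
    by (simp add: a_def e_def l1g_norm_empirical)
  have e0: "0 \<le> e n" for n by (simp add: e_def l1g_norm_nonneg)
  have ev: "\<forall>\<^sub>F n in sequentially. e n < 1"
    using lim by (intro order_tendstoD(2)[of e 0]) (auto simp: e_def)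
  then obtain n0 where "e n0 < 1" by (auto simp: eventually_sequentially)
  then have "ereal (a n0) + e n0 < \<infinity>" using e0[of n0] by (cases "e n0") auto
  then obtain F where F: "l1g_norm f = ereal F"
    using le1[of n0] l1g_norm_nonneg[of f] by (cases "l1g_norm f") auto
  have re: "(\<lambda>n. real_of_ereal (e n)) \<longlonglongrightarrow> 0"
    using lim_real_of_ereal[of e 0] lim by (simp add: e_def zero_ereal_def)
  have "\<forall>\<^sub>F n in sequentially. norm (a n - F) \<le> real_of_ereal (e n)"
    using ev
  proof eventually_elim
    case (elim n)
    then obtain r where "e n = ereal r" using e0[of n] by (cases "e n") auto
    then show ?case using le1[of n] le2[of n] F by auto
  qed
  then have "(\<lambda>n. a n - F) \<longlonglongrightarrow> 0" by (rule Lim_null_comparison[OF _ re])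
  then have "a \<longlonglongrightarrow> F" by (rule LIM_zero_cancel)
  then show thesis using F that by (simp add: a_def)
qed

text \<open>Cubing \<open>M \<le> c * L^(2/3)\<close> and inserting \<open>bound\<close> gives
  \<open>M^3 \<le> c^3 * n^2 * M\<close>, hence \<open>M^2 \<le> c^3 * n^2\<close> when
  \<open>M\<close> is positive.\<close>

lemma degree_product_small:
  fixes L M :: "nat \<Rightarrow> real"
  assumes L: "\<And>n. 0 \<le> L n" and M: "\<And>n. 0 \<le> M n"
    and bound: "\<And>n. (L n)\<^sup>2 \<le> (real n)\<^sup>2 * M n"
    and small: "M \<in> o(\<lambda>n. L n powr (2 / 3))"
  shows "(\<lambda>n. M n / real n) \<longlonglongrightarrow> 0"
proof (rule LIMSEQ_I)
  fix r :: real assume r: "0 < r"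
  \<comment> \<open>Then \<open>c^3 \<le> c \<le> (r / 2)^2\<close>, and the square root leaves
    \<open>r / 2\<close>, strictly below \<open>r\<close>.\<close>
  define c where "c = min 1 ((r / 2)\<^sup>2)"
  have c: "0 < c" "c \<le> 1" "c \<le> (r / 2)\<^sup>2" using r by (auto simp: c_def)
  have "\<forall>\<^sub>F n in sequentially. norm (M n) \<le> c * norm (L n powr (2 / 3))"
    using landau_o.smallD[OF small c(1)] .
  then obtain N where N: "\<And>n. N \<le> n \<Longrightarrow> M n \<le> c * L n powr (2 / 3)"
    using M by (auto simp: eventually_sequentially)
  have "norm (M n / real n - 0) < r" if n: "max N 1 \<le> n" for n
  proof (cases "M n = 0")
    case False
    then have Mpos: "0 < M n" using M[of n] by simp
    have "(M n) ^ 3 \<le> (c * L n powr (2 / 3)) ^ 3" using N n M by (intro power_mono) auto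
    also have "\<dots> = c ^ 3 * (L n)\<^sup>2"
    proof -
      have "(L n powr (2 / 3)) ^ 3 = (L n)\<^sup>2"
        using L[of n] by (cases "L n = 0") (simp_all add: powr_power)
      then show ?thesis by (simp only: power_mult_distrib)
    qed
    also have "\<dots> \<le> c ^ 3 * ((real n)\<^sup>2 * M n)" using bound c by (intro mult_left_mono) auto
    finally have "(M n)\<^sup>2 \<le> c ^ 3 * (real n)\<^sup>2" using Mpos by (simp add: power3_eq_cube power2_eq_square)
    also have "c ^ 3 \<le> c * 1" unfolding power3_eq_cube using c by (simp add: mult_le_one)
    then have "c ^ 3 * (real n)\<^sup>2 \<le> (r / 2)\<^sup>2 * (real n)\<^sup>2" using c by (intro mult_right_mono) auto
    also have "\<dots> = (r / 2 * real n)\<^sup>2" by (rule power_mult_distrib[symmetric])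
    finally have "(M n)\<^sup>2 \<le> (r / 2 * real n)\<^sup>2" .
    then have "M n \<le> r / 2 * real n" by (rule power2_le_imp_le) (use r in simp)
    moreover have "0 < real n" using n by simp
    ultimately show ?thesis using r Mpos by (simp add: divide_less_eq)
  qed (use r in simp)
  then show "\<exists>N. \<forall>n\<ge>N. norm (M n / real n - 0) < r" by blast
qed

section \<open>Relative entropy per node\<close>

text \<open>The limit is taken in the extended reals, where the norms live; both norms turn out
  finite, so the argument runs on real sequences.\<close>

theorem theorem1p5:
  fixes n\<^sub>1 n\<^sub>2 :: "nat \<Rightarrow> nat"
    and \<Lambda>\<^sub>1 \<Lambda>\<^sub>2 :: "nat \<Rightarrow> 'v set"
    and k k' :: "nat \<Rightarrow> 'v \<Rightarrow> nat"
    and P\<^sub>c\<^sub>a\<^sub>n :: "nat \<Rightarrow> 'v set set \<Rightarrow> real"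
    and L m m' :: "nat \<Rightarrow> nat"
    and A\<^sub>1 A\<^sub>2 :: real
    and f\<^sub>1\<^sub>2 f\<^sub>2\<^sub>1 :: "nat pmf"
  assumes "\<And>n. n\<^sub>1 n + n\<^sub>2 n = n"
    and "\<forall>\<^sub>F n in sequentially. 0 < n\<^sub>1 n \<and> 0 < n\<^sub>2 n"
    and "\<And>n. finite (\<Lambda>\<^sub>1 n)" and "\<And>n. finite (\<Lambda>\<^sub>2 n)"
    and "\<And>n. card (\<Lambda>\<^sub>1 n) = n\<^sub>1 n" and "\<And>n. card (\<Lambda>\<^sub>2 n) = n\<^sub>2 n"
    and "\<And>n. \<Lambda>\<^sub>1 n \<inter> \<Lambda>\<^sub>2 n = {}"
    and "\<And>n. \<exists>E \<in> bipartite_graphs (\<Lambda>\<^sub>1 n) (\<Lambda>\<^sub>2 n).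
           (\<forall>i\<in>\<Lambda>\<^sub>1 n. layer1_degree (\<Lambda>\<^sub>2 n) E i = k n i) \<and>
           (\<forall>j\<in>\<Lambda>\<^sub>2 n. layer2_degree (\<Lambda>\<^sub>1 n) E j = k' n j)"
    and "\<And>n. is_degree_canonical (\<Lambda>\<^sub>1 n) (\<Lambda>\<^sub>2 n) (k n) (k' n) (P\<^sub>c\<^sub>a\<^sub>n n)"
    and "\<And>n. L n = (\<Sum>i\<in>\<Lambda>\<^sub>1 n. k n i)"
    and "\<And>n. m n = Max (k n ` \<Lambda>\<^sub>1 n)"
    and "\<And>n. m' n = Max (k' n ` \<Lambda>\<^sub>2 n)"
    and "(\<lambda>n. real (n\<^sub>1 n) / real (n\<^sub>1 n + n\<^sub>2 n)) \<longlonglongrightarrow> A\<^sub>1"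
    and "(\<lambda>n. real (n\<^sub>2 n) / real (n\<^sub>1 n + n\<^sub>2 n)) \<longlonglongrightarrow> A\<^sub>2"
    and "(\<lambda>n. real (m n) * real (m' n)) \<in> o(\<lambda>n. real (L n) powr (2 / 3))"
    and "(\<lambda>n. l1g_norm (\<lambda>q. empirical (\<Lambda>\<^sub>1 n) (k n) q - pmf f\<^sub>1\<^sub>2 q)) \<longlonglongrightarrow> 0"
    and "(\<lambda>n. l1g_norm (\<lambda>q. empirical (\<Lambda>\<^sub>2 n) (k' n) q - pmf f\<^sub>2\<^sub>1 q)) \<longlonglongrightarrow> 0"
  shows "(\<lambda>n. ereal (relative_entropy (bipartite_graphs (\<Lambda>\<^sub>1 n) (\<Lambda>\<^sub>2 n))
                (degree_microcanonical (\<Lambda>\<^sub>1 n) (\<Lambda>\<^sub>2 n) (k n) (k' n)) (P\<^sub>c\<^sub>a\<^sub>n n) / real (n\<^sub>1 n + n\<^sub>2 n)))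
         \<longlonglongrightarrow> ereal A\<^sub>1 * l1g_norm (pmf f\<^sub>1\<^sub>2) + ereal A\<^sub>2 * l1g_norm (pmf f\<^sub>2\<^sub>1)"
proof -
  define M where "M = (\<lambda>n. real (m n) * real (m' n))"
  define S where "S = (\<lambda>n. relative_entropy (bipartite_graphs (\<Lambda>\<^sub>1 n) (\<Lambda>\<^sub>2 n))
                (degree_microcanonical (\<Lambda>\<^sub>1 n) (\<Lambda>\<^sub>2 n) (k n) (k' n)) (P\<^sub>c\<^sub>a\<^sub>n n))"
  define R where "R = (\<lambda>n. (\<Sum>i\<in>\<Lambda>\<^sub>1 n. stirling_g (k n i)) + (\<Sum>j\<in>\<Lambda>\<^sub>2 n. stirling_g (k' n j)))"
  obtain F\<^sub>1 where F\<^sub>1: "l1g_norm (pmf f\<^sub>1\<^sub>2) = ereal F\<^sub>1"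
    "(\<lambda>n. (\<Sum>i\<in>\<Lambda>\<^sub>1 n. stirling_g (k n i)) / real (card (\<Lambda>\<^sub>1 n))) \<longlonglongrightarrow> F\<^sub>1"
    using l1g_norm_limit[OF assms(3) assms(16)] .
  obtain F\<^sub>2 where F\<^sub>2: "l1g_norm (pmf f\<^sub>2\<^sub>1) = ereal F\<^sub>2"
    "(\<lambda>n. (\<Sum>j\<in>\<Lambda>\<^sub>2 n. stirling_g (k' n j)) / real (card (\<Lambda>\<^sub>2 n))) \<longlonglongrightarrow> F\<^sub>2"
    using l1g_norm_limit[OF assms(4) assms(17)] .
  have sums: "(\<Sum>i\<in>\<Lambda>\<^sub>1 n. k n i) = (\<Sum>j\<in>\<Lambda>\<^sub>2 n. k' n j)" for n
  proof -
    obtain E where E: "\<forall>i\<in>\<Lambda>\<^sub>1 n. layer1_degree (\<Lambda>\<^sub>2 n) E i = k n i"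
      "\<forall>j\<in>\<Lambda>\<^sub>2 n. layer2_degree (\<Lambda>\<^sub>1 n) E j = k' n j"
      using assms(8)[of n] by blast
    have "(\<Sum>i\<in>\<Lambda>\<^sub>1 n. k n i) = (\<Sum>i\<in>\<Lambda>\<^sub>1 n. \<Sum>j\<in>\<Lambda>\<^sub>2 n. adj E i j)"
      using E(1) by (intro sum.cong) (auto simp: layer1_degree_def)
    also have "\<dots> = (\<Sum>j\<in>\<Lambda>\<^sub>2 n. \<Sum>i\<in>\<Lambda>\<^sub>1 n. adj E i j)" by (rule sum.swap)
    also have "\<dots> = (\<Sum>j\<in>\<Lambda>\<^sub>2 n. k' n j)"
      using E(2) by (intro sum.cong) (auto simp: layer2_degree_def)
    finally show ?thesis .
  qed
  have loc: "bipartite_degrees (\<Lambda>\<^sub>1 n) (\<Lambda>\<^sub>2 n) (k n) (k' n)" for n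
    by unfold_locales (use assms(3,4,7) sums in auto)
  have km: "k n i \<le> m n" if "i \<in> \<Lambda>\<^sub>1 n" for n i
    unfolding assms(11) using that assms(3) by (intro Max_ge) auto
  have km': "k' n j \<le> m' n" if "j \<in> \<Lambda>\<^sub>2 n" for n j
    unfolding assms(12) using that assms(4) by (intro Max_ge) auto
  have L_le: "L n \<le> n * m n" "L n \<le> n * m' n" for n
  proof -
    have "L n \<le> n\<^sub>1 n * m n" unfolding assms(10)
      using sum_bounded_above[of "\<Lambda>\<^sub>1 n" "k n" "m n"] km assms(5) by simp
    also have "\<dots> \<le> n * m n" using assms(1)[of n] by (intro mult_right_mono) auto
    finally show "L n \<le> n * m n" .
    have "L n \<le> n\<^sub>2 n * m' n" unfolding assms(10) sums
      using sum_bounded_above[of "\<Lambda>\<^sub>2 n" "k' n" "m' n"] km' assms(6) by simp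
    also have "\<dots> \<le> n * m' n" using assms(1)[of n] by (intro mult_right_mono) auto
    finally show "L n \<le> n * m' n" .
  qed
  have L_sq: "(real (L n))\<^sup>2 \<le> (real n)\<^sup>2 * M n" for n
  proof -
    have "L n * L n \<le> (n * m n) * (n * m' n)" using L_le by (intro mult_le_mono)
    then have "real (L n * L n) \<le> real ((n * m n) * (n * m' n))" by (simp only: of_nat_le_iff)
    then show ?thesis by (simp add: M_def power2_eq_square mult_ac)
  qed
  have M_small: "(\<lambda>n. M n / real n) \<longlonglongrightarrow> 0"
    using degree_product_small[of "\<lambda>n. real (L n)" M] L_sq assms(15) by (simp add: M_def)
  have M_le_L: "\<forall>\<^sub>F n in sequentially. M n \<le> real (L n) / 64"
    using landau_o.smallD[OF assms(15), of "1 / 64", simplified]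
  proof eventually_elim
    case (elim n)
    \<comment> \<open>\<open>L n\<close> is a natural number, so it is 0 or at least 1, and a power
      with exponent below 1 does not exceed it.\<close>
    have "real (L n) powr (2 / 3) \<le> real (L n)"
      using powr_mono[of "2 / 3" 1 "real (L n)"] by (cases "L n = 0") auto
    with elim show ?case by (simp add: M_def abs_mult)
  qed
  have bound: "\<forall>\<^sub>F n in sequentially. norm (S n / real n - R n / real n)
      \<le> 1 / real n + 2 * (ln (real n) / real n) + 8 * (M n / real n)"
    using M_le_L eventually_gt_at_top[of 0]
  proof eventually_elim
    case (elim n)
    interpret bipartite_degrees "\<Lambda>\<^sub>1 n" "\<Lambda>\<^sub>2 n" "k n" "k' n" by (rule loc)
    have Ln: "bipartite_degrees.L (\<Lambda>\<^sub>1 n) (k n) = L n" by (simp add: L_def assms(10))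
    have "real (64 * (m n * m' n)) \<le> real (L n)" using elim by (simp add: M_def)
    then have "64 * (m n * m' n) \<le> L n" by (simp only: of_nat_le_iff)
    moreover have "sat \<noteq> {}" using assms(8)[of n] sat_iff by blast
    ultimately have "\<bar>S n - R n\<bar> \<le> \<bar>stirling_g (L n)\<bar> + 8 * M n"
      using relative_entropy_bounds[OF assms(9)[of n] _ km km'] by (simp add: S_def R_def M_def Ln)
    moreover have "\<bar>stirling_g (L n)\<bar> \<le> 1 + 2 * ln (real n)"
    proof (cases "L n = 0")
      case False
      \<comment> \<open>Inserting \<open>M n \<le> L n\<close> into \<open>L_sq\<close> yields
        \<open>L n \<le> n^2\<close>, which explains the factor 2 in front of
        \<open>ln (real n)\<close>.\<close>
      have "real (L n) * real (L n) \<le> (real n)\<^sup>2 * real (L n)"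
        using order_trans[OF L_sq[of n] mult_left_mono[of "M n" "real (L n)"]] elim
        by (simp add: power2_eq_square)
      then have "real (L n) \<le> (real n)\<^sup>2" using False by simp
      then have "ln (real (L n)) \<le> ln ((real n)\<^sup>2)" using False by (intro ln_mono) auto
      also have "\<dots> = 2 * ln (real n)" using elim by (simp add: ln_realpow)
      finally show ?thesis using stirling_g_le[of "L n"] stirling_g_nonneg[of "L n"] False by simp
    next
      case True
      then show ?thesis using elim by (simp add: stirling_g_def)
    qed
    ultimately have "\<bar>S n - R n\<bar> \<le> 1 + 2 * ln (real n) + 8 * M n" by linarith
    then have "\<bar>S n - R n\<bar> / real n \<le> (1 + 2 * ln (real n) + 8 * M n) / real n"
      by (rule divide_right_mono) simp
    then show ?case by (simp add: add_divide_distrib flip: diff_divide_distrib)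
  qed
  have "(\<lambda>n. 1 / real n + 2 * (ln (real n) / real n) + 8 * (M n / real n)) \<longlonglongrightarrow> 0 + 2 * 0 + 8 * 0"
    by (intro tendsto_intros M_small lim_ln_over_n lim_1_over_n)
  then have diff: "(\<lambda>n. S n / real n - R n / real n) \<longlonglongrightarrow> 0"
    using Lim_null_comparison[OF bound] by simp
  have "(\<lambda>n. real (n\<^sub>1 n) / real (n\<^sub>1 n + n\<^sub>2 n) * ((\<Sum>i\<in>\<Lambda>\<^sub>1 n. stirling_g (k n i)) / real (card (\<Lambda>\<^sub>1 n)))
      + real (n\<^sub>2 n) / real (n\<^sub>1 n + n\<^sub>2 n) * ((\<Sum>j\<in>\<Lambda>\<^sub>2 n. stirling_g (k' n j)) / real (card (\<Lambda>\<^sub>2 n))))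
      \<longlonglongrightarrow> A\<^sub>1 * F\<^sub>1 + A\<^sub>2 * F\<^sub>2"
    by (intro tendsto_intros assms(13,14) F\<^sub>1 F\<^sub>2)
  \<comment> \<open>The layer fractions turn averages over each layer into sums divided by
    \<open>n\<close>.\<close>
  moreover have "\<forall>\<^sub>F n in sequentially.
      real (n\<^sub>1 n) / real (n\<^sub>1 n + n\<^sub>2 n) * ((\<Sum>i\<in>\<Lambda>\<^sub>1 n. stirling_g (k n i)) / real (card (\<Lambda>\<^sub>1 n)))
      + real (n\<^sub>2 n) / real (n\<^sub>1 n + n\<^sub>2 n) * ((\<Sum>j\<in>\<Lambda>\<^sub>2 n. stirling_g (k' n j)) / real (card (\<Lambda>\<^sub>2 n)))
      = R n / real n"
    using assms(2)
  proof eventually_elim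
    case (elim n)
    then show ?case
      unfolding assms(1) by (simp add: assms(5,6) R_def add_divide_distrib)
  qed
  ultimately have "(\<lambda>n. R n / real n) \<longlonglongrightarrow> A\<^sub>1 * F\<^sub>1 + A\<^sub>2 * F\<^sub>2"
    by (rule Lim_transform_eventually)
  from tendsto_add[OF diff this] have "(\<lambda>n. S n / real n) \<longlonglongrightarrow> A\<^sub>1 * F\<^sub>1 + A\<^sub>2 * F\<^sub>2" by simp
  then have "(\<lambda>n. ereal (S n / real n)) \<longlonglongrightarrow> ereal (A\<^sub>1 * F\<^sub>1 + A\<^sub>2 * F\<^sub>2)" by (rule tendsto_ereal)
  then show ?thesis by (simp add: S_def F\<^sub>1 F\<^sub>2 assms(1))
qed

end
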